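(* There is a $25$-dimensional configuration $A$ of $30$ points whose Delaunay triangulation $\mathcal{D}(A)$ has a disconnected realization space $\mathcal{R}_{\text{del}}(\mathcal{D}(A))$.
   Context: Point configurations are labeled by $[n]=\{1,\dots,n\}$. The Delaunay subdivision $\mathcal{D}(A)$ of $A\subset\mathbb{R}^d$ consists of all cells $C$ (polytopes with vertices in $A$) for which there is a $(d-1)$-sphere passing through all vertices of $C$ with all other points of $A$ outside this sphere; it is a Delaunay triangulation if all cells are simplices. Subdivisions are identified with posets of subsets of $[n]$, and $\simeq$ means that these posets coincide. For a Delaunay triangulation $T$ of $n$ points in $\mathbb{R}^d$, the realization space is the quotient $\mathcal{R}_{\text{del}}(T)=\{B\in\mathbb{R}^{d\times n} : \mathcal{D}(B)\simeq T\}/\operatorname{Sim}(\mathbb{R}^d)$, where $\operatorname{Sim}(\mathbb{R}^d)$ is the group of similarities of $\mathbb{R}^d$. *)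

theory Defs
  imports "HOL-Analysis.Analysis"
begin

text \<open>A labeled configuration of \<open>n\<close> points in \<open>\<real>\<^sup>d\<close>, that is, a matrix in \<open>\<real>\<^bsup>d\<times>n\<^esup>\<close>, is an
  element of \<^typ>\<open>(real^'d)^'n\<close>: the component \<open>A $ i\<close> is the point labeled \<open>i\<close> (the \<open>i\<close>-th column
  of the matrix). The finite index type \<^typ>\<open>'n\<close> plays the role of \<open>[n]\<close>.\<close>

type_synonym ('d, 'n) config = "(real^'d)^'n"

definition config_points :: "('d::finite, 'n::finite) config \<Rightarrow> (real^'d) set" where
  "config_points A = range (\<lambda>i. A $ i)"

definition polytope_vertices :: "(real^'d) set \<Rightarrow> (real^'d) set" where
  "polytope_vertices C = {v. v extreme_point_of C}"

text \<open>The empty polytope is vacuously a cell, so every Delaunay subdivision contains the empty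
  face.\<close>

definition delaunay_subdivision :: "('d::finite, 'n::finite) config \<Rightarrow> (real^'d) set set" where
  "delaunay_subdivision A = {C. polytope C \<and> polytope_vertices C \<subseteq> config_points A \<and>
     (\<exists>c r. r > 0 \<and> polytope_vertices C \<subseteq> sphere c r \<and>
        (\<forall>p \<in> config_points A - polytope_vertices C. dist c p > r))}"

definition is_delaunay_triangulation :: "('d::finite, 'n::finite) config \<Rightarrow> bool" where
  "is_delaunay_triangulation A \<longleftrightarrow> (\<forall>C \<in> delaunay_subdivision A. \<exists>k. k simplex C)"

text \<open>The poset of subsets of \<open>[n]\<close> identified with the Delaunay subdivision. The order is always
  inclusion, so two such posets coincide iff they are equal as families of subsets.\<close>

definition delaunay_poset :: "('d::finite, 'n::finite) config \<Rightarrow> 'n set set" where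
  "delaunay_poset A = (\<lambda>C. {i. A $ i \<in> polytope_vertices C}) ` delaunay_subdivision A"

text \<open>Orientation-reversing similarities are included. Bijectivity is automatic, since a
  distance-scaling self-map of a Euclidean space is affine.\<close>

definition similarities :: "(real^'d::finite \<Rightarrow> real^'d) set" where
  "similarities = {f. \<exists>c>0. \<forall>x y. dist (f x) (f y) = c * dist x y}"

definition similarity_orbit :: "('d::finite, 'n::finite) config \<Rightarrow> ('d, 'n) config set" where
  "similarity_orbit B = (\<lambda>f. \<chi> i. f (B $ i)) ` similarities"

definition quotient_topology :: "'a topology \<Rightarrow> ('a \<Rightarrow> 'b) \<Rightarrow> 'b topology" where
  "quotient_topology X q =
     topology (\<lambda>U. U \<subseteq> q ` topspace X \<and> openin X {x \<in> topspace X. q x \<in> U})"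

lemma openin_quotient_topology:
  "openin (quotient_topology X q) U \<longleftrightarrow>
     U \<subseteq> q ` topspace X \<and> openin X {x \<in> topspace X. q x \<in> U}"
proof -
  have "istopology (\<lambda>U. U \<subseteq> q ` topspace X \<and> openin X {x \<in> topspace X. q x \<in> U})"
    unfolding istopology_def
  proof (intro conjI allI impI)
    fix S T
    assume "S \<subseteq> q ` topspace X \<and> openin X {x \<in> topspace X. q x \<in> S}"
      and "T \<subseteq> q ` topspace X \<and> openin X {x \<in> topspace X. q x \<in> T}"
    moreover have "{x \<in> topspace X. q x \<in> S \<inter> T} =
        {x \<in> topspace X. q x \<in> S} \<inter> {x \<in> topspace X. q x \<in> T}"
      by auto
    ultimately show "S \<inter> T \<subseteq> q ` topspace X" "openin X {x \<in> topspace X. q x \<in> S \<inter> T}"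
      by auto
  next
    fix K
    assume K: "\<forall>U\<in>K. U \<subseteq> q ` topspace X \<and> openin X {x \<in> topspace X. q x \<in> U}"
    then show "\<Union>K \<subseteq> q ` topspace X"
      by blast
    have "{x \<in> topspace X. q x \<in> \<Union>K} = (\<Union>U\<in>K. {x \<in> topspace X. q x \<in> U})"
      by auto
    with K show "openin X {x \<in> topspace X. q x \<in> \<Union>K}"
      by auto
  qed
  then show ?thesis
    by (simp add: quotient_topology_def topology_inverse')
qed

lemma topspace_quotient_topology [simp]: "topspace (quotient_topology X q) = q ` topspace X"
proof (rule antisym)
  show "topspace (quotient_topology X q) \<subseteq> q ` topspace X"
    using openin_quotient_topology[of X q] by (auto simp: topspace_def)
  have "{x \<in> topspace X. q x \<in> q ` topspace X} = topspace X"
    by auto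
  then have "openin (quotient_topology X q) (q ` topspace X)"
    by (simp add: openin_quotient_topology)
  then show "q ` topspace X \<subseteq> topspace (quotient_topology X q)"
    by (rule openin_subset)
qed

lemma quotient_map_quotient_topology: "quotient_map X (quotient_topology X q) q"
  by (simp add: quotient_map_def openin_quotient_topology)

text \<open>Points of the realization space are similarity classes. Similarities preserve the Delaunay
  poset, so the orbit of a realization consists of realizations.\<close>

definition delaunay_realization_space ::
    "'n set set \<Rightarrow> ('d::finite, 'n::finite) config set topology" where
  "delaunay_realization_space T =
     quotient_topology (top_of_set {B. delaunay_poset B = T}) similarity_orbit"

end

theory Submission
  imports Defs
begin

text \<open>Sets of labels that are Delaunay cells are the zero sets, on the labels, of power functions
  \<open>\<bar>x\<bar>\<^sup>2 - 2 c \<bullet> x + h\<close> that are nonnegative on the configuration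
  (\<open>delaunay_poset_eq\<close>). The linear relations between the values of such functions at \<open>30\<close>
  points of \<open>\<real>\<^bsup>25\<^esup>\<close> (in sufficiently general position) form a space of dimension
  \<open>30 - 27 = 3\<close>, the circuit space. It attaches to the labels \<open>30\<close> vectors in
  \<open>\<real>\<^sup>3\<close>, unique up to a linear map, and it depends only on the similarity class of the
  configuration. The power function of a cell is a positive dependency between the vectors labeled off the cell.

  The triangulation used here is the cone over the boundary of a simplicial \<open>25\<close>-polytope with
  \<open>29\<close> vertices: apart from the apex, a set is a cell iff the vectors labeled by its complement are
  positively dependent (\<open>lower_face_star_iff\<close>). Any vector configuration with suitable positive weights
  can be realized in this way. For generic vectors, positive dependence is governed by the positive circuits, the
  positively dependent sets of four vectors (\<open>pos_dep_cong_circuits\<close>).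

  Hence it suffices to find two configurations of vectors in \<open>\<real>\<^sup>3\<close> with the same positive
  circuits that cannot be deformed into each other with these circuits kept. The lists \<open>plus_list\<close> and
  \<open>minus_list\<close> are such a pair (\<open>same_circuits\<close>). A positive circuit fixes the orientations
  of its four triples up to a common sign, and a chain of circuits with common triples transports orientations from a
  frame to all the triples of interest (\<open>forced_brackets\<close>). These orientations translate into
  inequalities between points and lines in an affine plane. The inequality between arithmetic and geometric means, in
  the shape of lines tangent to hyperbolas, then shows that a certain polynomial, the gap, vanishes at no realization
  (\<open>icpt_product_mono\<close>, \<open>secant_hyperbola_caps\<close>, \<open>secant_gap_nonzero\<close>). The gap
  is not a determinant of three of the vectors, so the circuits do not fix its sign, and indeed it is positive for one
  list and negative for the other.

  Its sign is continuous along realizations and invariant under similarities. A compactness argument turns this into a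
  partition of the realization space into two nonempty open sets (\<open>closed_gap_side\<close>,
  \<open>disconnected\<close>).\<close>

section \<open>Delaunay cells as lower faces\<close>

text \<open>With \<open>h = \<bar>c\<bar>\<^sup>2 - r\<^sup>2\<close> the expression is the power of
  \<open>A $ i\<close> with respect to the sphere of centre \<open>c\<close> and radius \<open>r\<close>. Leaving
  \<open>h\<close> arbitrary, so that \<open>r\<^sup>2\<close> may be zero or negative, makes the conditions linear in
  \<open>(c, h)\<close>: they describe the lower faces of the points lifted to the paraboloid.\<close>
definition lower_face :: "('d::finite, 'n::finite) config \<Rightarrow> 'n set \<Rightarrow> bool" where
  "lower_face A S \<longleftrightarrow> (\<exists>c h. (\<forall>i\<in>S. (norm (A $ i))\<^sup>2 - 2 * (c \<bullet> (A $ i)) + h = 0) \<and>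
     (\<forall>i. i \<notin> S \<longrightarrow> (norm (A $ i))\<^sup>2 - 2 * (c \<bullet> (A $ i)) + h > 0))"

lemma power_expand:
  fixes a c :: "'a::real_inner"
  shows "(dist c a)\<^sup>2 - r\<^sup>2 = (norm a)\<^sup>2 - 2 * (c \<bullet> a) + ((norm c)\<^sup>2 - r\<^sup>2)"
  by (simp add: dist_norm power2_norm_eq_inner inner_diff_left inner_diff_right inner_commute)

lemma lower_face_if_mem_poset:
  assumes "S \<in> delaunay_poset A" shows "lower_face A S"
proof -
  obtain C c r where C: "S = {i. A $ i \<in> polytope_vertices C}" "r > 0"
      "polytope_vertices C \<subseteq> sphere c r" "\<forall>p\<in>config_points A - polytope_vertices C. dist c p > r"
    using assms by (auto simp: delaunay_poset_def delaunay_subdivision_def)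
  have "\<forall>i\<in>S. (norm (A $ i))\<^sup>2 - 2 * (c \<bullet> (A $ i)) + ((norm c)\<^sup>2 - r\<^sup>2) = 0"
  proof
    fix i assume "i \<in> S"
    hence "dist c (A $ i) = r" using C by auto
    thus "(norm (A $ i))\<^sup>2 - 2 * (c \<bullet> (A $ i)) + ((norm c)\<^sup>2 - r\<^sup>2) = 0"
      using power_expand[of c "A $ i" r] by simp
  qed
  moreover have "(norm (A $ i))\<^sup>2 - 2 * (c \<bullet> (A $ i)) + ((norm c)\<^sup>2 - r\<^sup>2) > 0" if "i \<notin> S" for i
  proof -
    have "r < dist c (A $ i)" using C that by (auto simp: config_points_def)
    hence "r\<^sup>2 < (dist c (A $ i))\<^sup>2" using C by (intro power_strict_mono) auto
    thus ?thesis using power_expand[of c "A $ i" r] by simp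
  qed
  ultimately show ?thesis unfolding lower_face_def by blast
qed

text \<open>By strict convexity of the ball, no point of a sphere lies inside a segment of the ball.\<close>
lemma extreme_points_hull_sphere:
  fixes V :: "'a::euclidean_space set"
  assumes "V \<subseteq> sphere c r"
  shows "{v. v extreme_point_of (convex hull V)} = V"
proof
  show "{v. v extreme_point_of (convex hull V)} \<subseteq> V"
    using extreme_point_of_convex_hull by blast
  show "V \<subseteq> {v. v extreme_point_of (convex hull V)}"
  proof
    fix v assume v: "v \<in> V"
    have sub: "convex hull V \<subseteq> cball c r"
      using assms by (intro hull_minimal) auto
    have "v \<notin> open_segment a b" if "a \<in> convex hull V" "b \<in> convex hull V" for a b
    proof
      assume "v \<in> open_segment a b"
      hence "dist c v < dist c a \<or> dist c v < dist c b" by (rule dist_decreases_open_segment)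
      moreover have "dist c a \<le> r" "dist c b \<le> r" "dist c v = r"
        using that sub v assms by (auto simp: subset_eq)
      ultimately show False by linarith
    qed
    thus "v \<in> {v. v extreme_point_of (convex hull V)}"
      using v hull_subset[of V convex] unfolding extreme_point_of_def by blast
  qed
qed

lemma mem_poset_if_sphere:
  assumes inj: "inj (\<lambda>i. A $ i)" and "r > 0" and S: "\<forall>i\<in>S. dist c (A $ i) = r"
    and out: "\<forall>i. i \<notin> S \<longrightarrow> dist c (A $ i) > r"
  shows "S \<in> delaunay_poset A"
proof -
  let ?V = "(\<lambda>i. A $ i) ` S"
  have V: "polytope_vertices (convex hull ?V) = ?V"
    unfolding polytope_vertices_def using S by (intro extreme_points_hull_sphere[of _ c r]) auto
  have "convex hull ?V \<in> delaunay_subdivision A"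
    unfolding delaunay_subdivision_def mem_Collect_eq V
    using assms by (auto simp: config_points_def intro!: polytope_convex_hull exI[of _ c] exI[of _ r])
  moreover have "S = {i. A $ i \<in> polytope_vertices (convex hull ?V)}"
    unfolding V using inj by (auto simp: inj_def)
  ultimately show ?thesis unfolding delaunay_poset_def by blast
qed

text \<open>Two distinct points with vanishing power force the sphere to have positive radius, so it is an honest
  circumscribing sphere. A lower face with at most one label needs a separate small sphere, because there the sphere
  of the definition may degenerate to a point or be imaginary.\<close>
lemma mem_poset_if_lower_face:
  fixes A :: "('d::finite, 'n::finite) config"
  assumes inj: "inj (\<lambda>i. A $ i)" and lf: "lower_face A S"
  shows "S \<in> delaunay_poset A"
proof -
  obtain c h where ch: "\<forall>i\<in>S. (norm (A $ i))\<^sup>2 - 2 * (c \<bullet> (A $ i)) + h = 0"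
      "\<forall>i. i \<notin> S \<longrightarrow> (norm (A $ i))\<^sup>2 - 2 * (c \<bullet> (A $ i)) + h > 0"
    using lf by (auto simp: lower_face_def)
  show ?thesis
  proof (cases "\<exists>i j. i \<in> S \<and> j \<in> S \<and> i \<noteq> j")
    case True
    then obtain i j where ij: "i \<in> S" "j \<in> S" "i \<noteq> j" by blast
    have d: "(dist c (A $ k))\<^sup>2 - ((norm c)\<^sup>2 - h) = (norm (A $ k))\<^sup>2 - 2 * (c \<bullet> (A $ k)) + h" for k
      using power_expand[of c "A $ k" 0] by simp
    define r where "r = dist c (A $ i)"
    have r2: "r\<^sup>2 = (norm c)\<^sup>2 - h" using d[of i] ch ij by (simp add: r_def)
    have eq: "dist c (A $ k) = r" if "k \<in> S" for k
    proof -
      have "(dist c (A $ k))\<^sup>2 = r\<^sup>2" using d[of k] ch that r2 by simp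
      thus ?thesis by (simp add: r_def)
    qed
    have "r \<noteq> 0"
      using eq[OF ij(1)] eq[OF ij(2)] ij(3) inj by (auto simp: inj_def)
    hence "r > 0" by (simp add: r_def order_less_le)
    moreover have "dist c (A $ k) > r" if "k \<notin> S" for k
    proof -
      have "(norm (A $ k))\<^sup>2 - 2 * (c \<bullet> (A $ k)) + h > 0" using ch(2) that by blast
      hence "r\<^sup>2 < (dist c (A $ k))\<^sup>2" using d[of k] r2 by linarith
      thus ?thesis by (simp add: power2_less_imp_less)
    qed
    ultimately show ?thesis using eq mem_poset_if_sphere[OF inj] by blast
  next
    case False
    \<comment> \<open>A small sphere through the single vertex, or around a point off the configuration.\<close>
    define P where "P = config_points A"
    have fin: "finite P" by (simp add: P_def config_points_def)
    obtain q where q: "q \<in> P \<longleftrightarrow> S \<noteq> {}" "\<forall>i\<in>S. A $ i = q"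
    proof (cases "S = {}")
      case True
      have "P \<noteq> UNIV" using fin finite_imp_not_open[of P] by auto
      thus ?thesis using True that by blast
    next
      case F: False
      then obtain i where i: "i \<in> S" by blast
      have "\<forall>j\<in>S. A $ j = A $ i" using False i by blast
      moreover have "A $ i \<in> P" by (simp add: P_def config_points_def)
      ultimately show ?thesis using that[of "A $ i"] F by blast
    qed
    obtain e where e: "e > 0" "\<forall>p\<in>P - {q}. e \<le> dist q p"
      using finite_set_avoid[OF fin, of q] by auto
    obtain u :: "real^'d" where u: "norm u = 1" using vector_choose_size[of 1] by auto
    define c where "c = q + (if S = {} then 0 else (e/3) *\<^sub>R u)"
    have cq: "dist c q = (if S = {} then 0 else e/3)" using u e by (simp add: c_def dist_norm)
    show ?thesis
    proof (rule mem_poset_if_sphere[OF inj, of "e/3" _ c])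
      show "e/3 > 0" using e by simp
      show "\<forall>i\<in>S. dist c (A $ i) = e/3" using q cq by auto
      show "\<forall>i. i \<notin> S \<longrightarrow> dist c (A $ i) > e/3"
      proof (intro allI impI)
        fix i assume i: "i \<notin> S"
        have "A $ i \<noteq> q"
        proof
          assume "A $ i = q"
          hence "q \<in> P" by (auto simp: P_def config_points_def)
          then obtain j where "j \<in> S" using q by blast
          hence "A $ j = A $ i" using q \<open>A $ i = q\<close> by simp
          thus False using inj i \<open>j \<in> S\<close> by (auto simp: inj_def)
        qed
        hence "e \<le> dist q (A $ i)" using e by (auto simp: P_def config_points_def)
        also have "\<dots> \<le> dist c q + dist c (A $ i)" by (metis dist_commute dist_triangle)
        finally show "dist c (A $ i) > e/3" using cq e by (auto split: if_splits)
      qed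
    qed
  qed
qed

lemma inj_if_singleton_faces:
  assumes "\<And>i. lower_face A {i}" shows "inj (\<lambda>i. A $ i)"
proof (rule injI, rule ccontr)
  fix i j assume eq: "A $ i = A $ j" and "i \<noteq> j"
  thus False using assms[of i] unfolding lower_face_def by force
qed

lemma delaunay_poset_eq:
  assumes "\<And>i. lower_face A {i}"
  shows "delaunay_poset A = {S. lower_face A S}"
  using lower_face_if_mem_poset mem_poset_if_lower_face[OF inj_if_singleton_faces[OF assms]] by blast

text \<open>An affine dependency \<open>y\<close> pairs with every power function to the same number
  \<open>\<Sum> y\<^sub>i \<bar>A\<^sub>i\<bar>\<^sup>2\<close>. Testing it against the lower face formed by the
  positive part of \<open>y\<close> shows that this number is negative; testing \<open>- y\<close> shows that it is
  positive. So the points of a face all of whose subsets are faces are affinely independent.\<close>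
lemma lower_face_dependency:
  fixes A :: "('d::finite, 'n::finite) config" and y :: "'n \<Rightarrow> real"
  assumes faces: "\<And>S'. S' \<subseteq> S \<Longrightarrow> lower_face A S'"
    and y: "(\<Sum>i\<in>UNIV. y i) = 0" "(\<Sum>i\<in>UNIV. y i *\<^sub>R A $ i) = 0" and supp: "\<And>i. i \<notin> S \<Longrightarrow> y i = 0"
  shows "y i = 0"
proof -
  have lift: "(\<Sum>i\<in>UNIV. y i * ((norm (A $ i))\<^sup>2 - 2 * (c \<bullet> (A $ i)) + h)) =
      (\<Sum>i\<in>UNIV. y i * (norm (A $ i))\<^sup>2)" for c h
  proof -
    have "(\<Sum>i\<in>UNIV. y i * ((norm (A $ i))\<^sup>2 - 2 * (c \<bullet> (A $ i)) + h)) =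
      (\<Sum>i\<in>UNIV. y i * (norm (A $ i))\<^sup>2) - 2 * (c \<bullet> (\<Sum>i\<in>UNIV. y i *\<^sub>R A $ i)) + h * (\<Sum>i\<in>UNIV. y i)"
      by (simp add: sum_subtractf sum.distrib sum_distrib_left inner_sum_right algebra_simps)
    thus ?thesis using y by simp
  qed
  have half: "(\<Sum>i\<in>UNIV. y i * (norm (A $ i))\<^sup>2) < 0" if "y j < 0" and "\<And>i. i \<notin> S \<Longrightarrow> y i = 0"
      and "(\<Sum>i\<in>UNIV. y i) = 0" "(\<Sum>i\<in>UNIV. y i *\<^sub>R A $ i) = 0" for y :: "'n \<Rightarrow> real" and j
  proof -
    have "lower_face A {i. y i > 0}" using that by (intro faces) force
    then obtain c h where ch: "\<And>i. y i > 0 \<Longrightarrow> (norm (A $ i))\<^sup>2 - 2 * (c \<bullet> (A $ i)) + h = 0"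
        "\<And>i. \<not> y i > 0 \<Longrightarrow> (norm (A $ i))\<^sup>2 - 2 * (c \<bullet> (A $ i)) + h > 0"
      by (auto simp: lower_face_def)
    have "(\<Sum>i\<in>UNIV. y i * ((norm (A $ i))\<^sup>2 - 2 * (c \<bullet> (A $ i)) + h)) < (\<Sum>i\<in>(UNIV::'n set). 0)"
    proof (rule sum_strict_mono_ex1)
      show "\<forall>i\<in>UNIV. y i * ((norm (A $ i))\<^sup>2 - 2 * (c \<bullet> (A $ i)) + h) \<le> 0"
      proof
        fix i show "y i * ((norm (A $ i))\<^sup>2 - 2 * (c \<bullet> (A $ i)) + h) \<le> 0"
          using ch[of i] by (cases "y i > 0") (auto intro!: mult_nonpos_nonneg)
      qed
      show "\<exists>i\<in>UNIV. y i * ((norm (A $ i))\<^sup>2 - 2 * (c \<bullet> (A $ i)) + h) < 0"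
        using ch(2)[of j] that(1) by (intro bexI[of _ j]) (auto intro!: mult_neg_pos)
    qed auto
    moreover have "(\<Sum>i\<in>UNIV. y i * ((norm (A $ i))\<^sup>2 - 2 * (c \<bullet> (A $ i)) + h)) =
      (\<Sum>i\<in>UNIV. y i * (norm (A $ i))\<^sup>2) - 2 * (c \<bullet> (\<Sum>i\<in>UNIV. y i *\<^sub>R A $ i)) + h * (\<Sum>i\<in>UNIV. y i)"
      by (simp add: sum_subtractf sum.distrib sum_distrib_left inner_sum_right algebra_simps)
    ultimately show ?thesis using that by simp
  qed
  show ?thesis
  proof (rule ccontr)
    assume "y i \<noteq> 0"
    have "\<exists>j. y j < 0"
    proof (rule ccontr)
      assume "\<nexists>j. y j < 0"
      hence "\<forall>j\<in>UNIV. y j = 0" using y(1) sum_nonneg_eq_0_iff[of UNIV y] by (simp add: not_less)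
      thus False using \<open>y i \<noteq> 0\<close> by simp
    qed
    moreover have "\<exists>j. - y j < 0"
    proof (rule ccontr)
      assume "\<nexists>j. - y j < 0"
      hence "\<forall>j\<in>UNIV. - y j = 0" using y(1) sum_nonneg_eq_0_iff[of UNIV "\<lambda>j. - y j"]
        by (simp add: not_less sum_negf)
      thus False using \<open>y i \<noteq> 0\<close> by simp
    qed
    ultimately obtain j k where "y j < 0" "- y k < 0" by blast
    with half[of y j] half[of "\<lambda>i. - y i" k] show False
      using y supp by (simp add: sum_negf)
  qed
qed

lemma triangulation_if_faces_hereditary:
  fixes A :: "('d::finite, 'n::finite) config"
  assumes sing: "\<And>i. lower_face A {i}" and her: "\<And>S S'. lower_face A S \<Longrightarrow> S' \<subseteq> S \<Longrightarrow> lower_face A S'"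
  shows "is_delaunay_triangulation A"
  unfolding is_delaunay_triangulation_def
proof
  fix C assume C: "C \<in> delaunay_subdivision A"
  define S where "S = {i. A $ i \<in> polytope_vertices C}"
  define V where "V = polytope_vertices C"
  have inj: "inj (\<lambda>i. A $ i)" using sing by (rule inj_if_singleton_faces)
  have "S \<in> delaunay_poset A" using C by (auto simp: delaunay_poset_def S_def)
  hence lf: "lower_face A S" by (rule lower_face_if_mem_poset)
  have VS: "V = (\<lambda>i. A $ i) ` S" using C by (auto simp: V_def S_def delaunay_subdivision_def config_points_def)
  have "finite V" by (simp add: VS)
  have "\<not> affine_dependent V"
  proof
    assume "affine_dependent V"
    then obtain U where U: "sum U V = 0" "\<exists>v\<in>V. U v \<noteq> 0" "(\<Sum>v\<in>V. U v *\<^sub>R v) = 0"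
      using affine_dependent_explicit_finite[OF \<open>finite V\<close>] by auto
    define y where "y i = (if i \<in> S then U (A $ i) else 0)" for i
    have injS: "inj_on (\<lambda>i. A $ i) S" using inj by (rule inj_on_subset) simp
    have "(\<Sum>i\<in>UNIV. y i) = (\<Sum>i\<in>S. U (A $ i))"
      by (simp add: y_def sum.If_cases)
    also have "\<dots> = 0" using U(1) by (simp add: VS sum.reindex[OF injS] o_def)
    finally have 1: "(\<Sum>i\<in>UNIV. y i) = 0" .
    have "(\<Sum>i\<in>UNIV. y i *\<^sub>R A $ i) = (\<Sum>i\<in>S. U (A $ i) *\<^sub>R A $ i)"
      by (intro sum.mono_neutral_cong_right) (auto simp: y_def)
    also have "\<dots> = 0" using U(3) by (simp add: VS sum.reindex[OF injS] o_def)
    finally have 2: "(\<Sum>i\<in>UNIV. y i *\<^sub>R A $ i) = 0" .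
    have "y i = 0" for i
      by (rule lower_face_dependency[OF her[OF lf] 1 2]) (auto simp: y_def)
    moreover obtain i where "i \<in> S" "U (A $ i) \<noteq> 0" using U(2) VS by auto
    ultimately show False by (metis y_def)
  qed
  moreover have "C = convex hull V"
    using C Krein_Milman_Minkowski[of C] polytope_imp_compact polytope_imp_convex
    by (auto simp: delaunay_subdivision_def V_def polytope_vertices_def)
  ultimately show "\<exists>k. k simplex C"
    unfolding simplex_def by (intro exI[of _ "int (card V) - 1"] exI[of _ V]) simp
qed


section \<open>The circuit space\<close>

text \<open>The space of affine dependencies of the lifted points, written with mutual distances only so that its
  invariance under similarities is evident. For \<open>n\<close> points that span \<open>\<real>\<^sup>d\<close> and
  do not lie on a common sphere its dimension is \<open>n - d - 2\<close>, which is \<open>3\<close> for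
  \<open>30\<close> points in \<open>\<real>\<^bsup>25\<^esup>\<close>.\<close>
definition circuit_space :: "('d::finite, 'n::finite) config \<Rightarrow> (real^'n) set" where
  "circuit_space B = {y. (\<Sum>j\<in>UNIV. y $ j) = 0 \<and> (\<forall>i. (\<Sum>j\<in>UNIV. y $ j * (dist (B $ i) (B $ j))\<^sup>2) = 0)}"

text \<open>Expanding the squared distances turns the conditions into \<open>W - 2 B\<^sub>i \<bullet> s = 0\<close>
  with \<open>s = \<Sum> y\<^sub>j B\<^sub>j\<close>; averaging these equations with the weights
  \<open>y\<^sub>i\<close> gives \<open>s \<bullet> s = 0\<close>.\<close>
lemma mem_circuit_space_iff:
  "y \<in> circuit_space B \<longleftrightarrow> (\<Sum>j\<in>UNIV. y $ j) = 0 \<and> (\<Sum>j\<in>UNIV. y $ j *\<^sub>R B $ j) = 0 \<and>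
     (\<Sum>j\<in>UNIV. y $ j * (norm (B $ j))\<^sup>2) = 0"
proof -
  define s where "s = (\<Sum>j\<in>UNIV. y $ j *\<^sub>R B $ j)"
  define W where "W = (\<Sum>j\<in>UNIV. y $ j * (norm (B $ j))\<^sup>2)"
  define t where "t = (\<Sum>j\<in>UNIV. y $ j)"
  have D: "(\<Sum>j\<in>UNIV. y $ j * (dist (B $ i) (B $ j))\<^sup>2) = W - 2 * (B $ i \<bullet> s) + (norm (B $ i))\<^sup>2 * t" for i
  proof -
    have "(dist (B $ i) (B $ j))\<^sup>2 = (norm (B $ j))\<^sup>2 - 2 * (B $ i \<bullet> B $ j) + (norm (B $ i))\<^sup>2" for j
      using power_expand[of "B $ i" "B $ j" 0] by simp
    thus ?thesis unfolding W_def s_def t_def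
      by (simp only:) (simp add: sum_subtractf sum.distrib sum_distrib_left sum_distrib_right inner_sum_right algebra_simps)
  qed
  have "s = 0 \<and> W = 0" if "t = 0" and "\<And>i. W - 2 * (B $ i \<bullet> s) = 0"
  proof -
    have "0 = (\<Sum>i\<in>UNIV. y $ i * (W - 2 * (B $ i \<bullet> s)))" using that by simp
    also have "\<dots> = W * t - 2 * (s \<bullet> s)"
      unfolding s_def t_def
      by (simp add: sum_subtractf sum_distrib_left inner_sum_left algebra_simps)
    finally have "s = 0" using that by simp
    thus ?thesis using that(2) by simp
  qed
  thus ?thesis unfolding circuit_space_def mem_Collect_eq D s_def[symmetric] W_def[symmetric] t_def[symmetric]
    by auto
qed

lemma similarity_orbit_eq_circuit_space:
  assumes "similarity_orbit B = similarity_orbit B'"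
  shows "circuit_space B = circuit_space B'"
proof -
  have "id \<in> similarities" by (auto simp: similarities_def intro!: exI[of _ 1])
  hence "B' \<in> similarity_orbit B'" by (auto simp: similarity_orbit_def vec_eq_iff intro!: image_eqI[of _ _ id])
  hence "B' \<in> similarity_orbit B" using assms by simp
  then obtain f where f: "f \<in> similarities" "B' = (\<chi> i. f (B $ i))" by (auto simp: similarity_orbit_def)
  then obtain c where c: "c > 0" "\<And>x y. dist (f x) (f y) = c * dist x y" by (auto simp: similarities_def)
  have "(\<Sum>j\<in>UNIV. y $ j * (dist (B' $ i) (B' $ j))\<^sup>2) = c\<^sup>2 * (\<Sum>j\<in>UNIV. y $ j * (dist (B $ i) (B $ j))\<^sup>2)" for y i
    by (simp add: f c power_mult_distrib sum_distrib_left mult_ac)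
  thus ?thesis using c by (simp add: circuit_space_def)
qed

lemma facet_relation:
  fixes B :: "('d::finite, 'n::finite) config"
  assumes "lower_face B S"
  obtains f where "\<And>i. i \<notin> S \<Longrightarrow> 0 < f i" "\<And>i. i \<in> S \<Longrightarrow> f i = 0"
    "\<And>y :: 'n \<Rightarrow> real. (\<Sum>i\<in>UNIV. y i) = 0 \<Longrightarrow> (\<Sum>i\<in>UNIV. y i *\<^sub>R B $ i) = 0 \<Longrightarrow>
       (\<Sum>i\<in>UNIV. f i * y i) = (\<Sum>i\<in>UNIV. y i * (norm (B $ i))\<^sup>2)"
proof -
  obtain c h where ch: "\<forall>i\<in>S. (norm (B $ i))\<^sup>2 - 2 * (c \<bullet> (B $ i)) + h = 0"
      "\<forall>i. i \<notin> S \<longrightarrow> (norm (B $ i))\<^sup>2 - 2 * (c \<bullet> (B $ i)) + h > 0"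
    using assms by (auto simp: lower_face_def)
  define f where "f i = (norm (B $ i))\<^sup>2 - 2 * (c \<bullet> (B $ i)) + h" for i
  have "(\<Sum>i\<in>UNIV. f i * y i) = (\<Sum>i\<in>UNIV. y i * (norm (B $ i))\<^sup>2)"
    if "(\<Sum>i\<in>UNIV. y i) = 0" "(\<Sum>i\<in>UNIV. y i *\<^sub>R B $ i) = 0" for y :: "'n \<Rightarrow> real"
  proof -
    have "(\<Sum>i\<in>UNIV. f i * y i) =
      (\<Sum>i\<in>UNIV. y i * (norm (B $ i))\<^sup>2) - 2 * (c \<bullet> (\<Sum>i\<in>UNIV. y i *\<^sub>R B $ i)) + h * (\<Sum>i\<in>UNIV. y i)"
      by (simp add: f_def sum_subtractf sum.distrib sum_distrib_left inner_sum_right algebra_simps)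
    thus ?thesis using that by simp
  qed
  moreover have "\<And>i. i \<notin> S \<Longrightarrow> 0 < f i" "\<And>i. i \<in> S \<Longrightarrow> f i = 0" using ch by (auto simp: f_def)
  ultimately show ?thesis using that by blast
qed

text \<open>The power function of a face is orthogonal to the circuit space and vanishes on the face. Hence it is a
  dependency, positive off the face, between the coordinate functionals of the circuit space.\<close>
lemma circuit_space_facet_relation:
  assumes "lower_face B S"
  obtains f where "\<And>i. i \<notin> S \<Longrightarrow> 0 < f i"
    "\<And>y. y \<in> circuit_space B \<Longrightarrow> (\<Sum>i\<in>- S. f i * y $ i) = 0"
proof -
  obtain f where f: "\<And>i. i \<notin> S \<Longrightarrow> 0 < f i" "\<And>i. i \<in> S \<Longrightarrow> f i = 0"
    "\<And>y. (\<Sum>i\<in>UNIV. y i) = 0 \<Longrightarrow> (\<Sum>i\<in>UNIV. y i *\<^sub>R B $ i) = 0 \<Longrightarrow>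
       (\<Sum>i\<in>UNIV. f i * y i) = (\<Sum>i\<in>UNIV. y i * (norm (B $ i))\<^sup>2)"
    using facet_relation[OF assms] by blast
  have "(\<Sum>i\<in>- S. f i * y $ i) = 0" if "y \<in> circuit_space B" for y
  proof -
    have "(\<Sum>i\<in>- S. f i * y $ i) = (\<Sum>i\<in>UNIV. f i * y $ i)"
      using f(2) by (intro sum.mono_neutral_left) auto
    thus ?thesis using f(3)[of "\<lambda>i. y $ i"] that by (simp add: mem_circuit_space_iff)
  qed
  thus ?thesis using f(1) that by blast
qed

lemma circuit_space_facet_inj:
  assumes "\<And>S'. S' \<subseteq> S \<Longrightarrow> lower_face B S'" "y \<in> circuit_space B" "\<And>i. i \<notin> S \<Longrightarrow> y $ i = 0"
  shows "y = 0"
proof -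
  have "y $ i = 0" for i
    by (rule lower_face_dependency[of S B "\<lambda>i. y $ i"]) (use assms in \<open>auto simp: mem_circuit_space_iff\<close>)
  thus ?thesis by (simp add: vec_eq_iff)
qed

lemma inj_on_if_faces:
  assumes her: "\<And>S'. S' \<subseteq> S \<Longrightarrow> lower_face B S'"
  shows "inj_on (\<lambda>i. B $ i) S"
proof (rule inj_onI, rule ccontr)
  fix i j assume ij: "i \<in> S" "j \<in> S" "B $ i = B $ j" "i \<noteq> j"
  thus False using her[of "{i}"] unfolding lower_face_def by force
qed

lemma affine_hull_facet:
  fixes B :: "('d::finite, 'n::finite) config"
  assumes her: "\<And>S'. S' \<subseteq> S \<Longrightarrow> lower_face B S'" and card: "card S = CARD('d) + 1"
  shows "affine hull ((\<lambda>i. B $ i) ` S) = UNIV"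
proof -
  note inj = inj_on_if_faces[OF her]
  define V where "V = (\<lambda>i. B $ i) ` S"
  have cV: "card V = CARD('d) + 1" using card card_image[OF inj] by (simp add: V_def)
  have fin: "finite V" by (simp add: V_def)
  have "\<not> affine_dependent V"
  proof
    assume "affine_dependent V"
    then obtain U where U: "sum U V = 0" "\<exists>v\<in>V. U v \<noteq> 0" "(\<Sum>v\<in>V. U v *\<^sub>R v) = 0"
      using affine_dependent_explicit_finite[OF fin] by auto
    define y where "y i = (if i \<in> S then U (B $ i) else 0)" for i
    have "(\<Sum>i\<in>UNIV. y i) = (\<Sum>i\<in>S. U (B $ i))" by (simp add: y_def sum.If_cases)
    hence 1: "(\<Sum>i\<in>UNIV. y i) = 0" using U(1) by (simp add: V_def sum.reindex[OF inj] o_def)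
    have "(\<Sum>i\<in>UNIV. y i *\<^sub>R B $ i) = (\<Sum>i\<in>S. U (B $ i) *\<^sub>R B $ i)"
      by (intro sum.mono_neutral_cong_right) (auto simp: y_def)
    hence 2: "(\<Sum>i\<in>UNIV. y i *\<^sub>R B $ i) = 0" using U(3) by (simp add: V_def sum.reindex[OF inj] o_def)
    have "y i = 0" for i by (rule lower_face_dependency[OF her 1 2]) (auto simp: y_def)
    moreover obtain i where "i \<in> S" "U (B $ i) \<noteq> 0" using U(2) V_def by auto
    ultimately show False by (metis y_def)
  qed
  thus ?thesis unfolding V_def[symmetric]
    using cV by (intro affine_independent_span_eq) simp_all
qed

text \<open>Over a facet, whose points affinely span the space, values of a circuit off the facet can be prescribed
  freely apart from the single linear condition of the facet: the remaining value at \<open>a\<close> is dictated by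
  that condition, and the values on the facet by barycentric coordinates.\<close>
lemma circuit_space_facet_extend:
  fixes B :: "('d::finite, 'n::finite) config"
  assumes her: "\<And>S'. S' \<subseteq> S \<Longrightarrow> lower_face B S'" and card: "card S = CARD('d) + 1"
    and f: "\<And>i. i \<notin> S \<Longrightarrow> 0 < f i" "\<And>y. y \<in> circuit_space B \<Longrightarrow> (\<Sum>i\<in>- S. f i * y $ i) = 0"
    and a: "a \<notin> S"
  obtains y where "y \<in> circuit_space B" "\<And>i. i \<notin> S \<Longrightarrow> i \<noteq> a \<Longrightarrow> y $ i = t i"
proof -
  define V where "V = (\<lambda>i. B $ i) ` S"
  have fin: "finite V" by (simp add: V_def)
  note inj = inj_on_if_faces[OF her]
  have "affine hull V = UNIV" using affine_hull_facet[OF her card] by (simp add: V_def)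
  hence "\<forall>j. \<exists>u. sum u V = 1 \<and> (\<Sum>v\<in>V. u v *\<^sub>R v) = B $ j"
    unfolding affine_hull_finite[OF fin] by blast
  then obtain u where u: "\<And>j. sum (u j) V = 1" "\<And>j. (\<Sum>v\<in>V. u j v *\<^sub>R v) = B $ j" by metis
  obtain g where g: "\<And>i. i \<notin> S \<Longrightarrow> 0 < g i" "\<And>i. i \<in> S \<Longrightarrow> g i = 0"
    "\<And>y. (\<Sum>i\<in>UNIV. y i) = 0 \<Longrightarrow> (\<Sum>i\<in>UNIV. y i *\<^sub>R B $ i) = 0 \<Longrightarrow>
       (\<Sum>i\<in>UNIV. g i * y i) = (\<Sum>i\<in>UNIV. y i * (norm (B $ i))\<^sup>2)"
    using facet_relation[OF her[OF subset_refl]] by blast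
  define s where "s i = (if i = a then - (\<Sum>j\<in>- S - {a}. g j * t j) / g a else t i)" for i
  define z where "z i = (if i \<in> S then - (\<Sum>j\<in>- S. s j * u j (B $ i)) else s i)" for i
  have z1: "(\<Sum>i\<in>UNIV. z i) = 0"
  proof -
    have "(\<Sum>i\<in>UNIV. z i) = (\<Sum>i\<in>S. z i) + (\<Sum>i\<in>- S. z i)"
      using sum.union_disjoint[of S "- S"] by simp
    also have "(\<Sum>i\<in>S. z i) = - (\<Sum>j\<in>- S. s j * (\<Sum>i\<in>S. u j (B $ i)))"
      by (subst sum_distrib_left, subst sum.swap) (simp add: z_def sum_negf)
    also have "\<dots> = - (\<Sum>j\<in>- S. s j)"
      using u(1) by (simp add: V_def sum.reindex[OF inj] o_def)
    finally show ?thesis by (simp add: z_def)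
  qed
  have z2: "(\<Sum>i\<in>UNIV. z i *\<^sub>R B $ i) = 0"
  proof -
    have "(\<Sum>i\<in>UNIV. z i *\<^sub>R B $ i) = (\<Sum>i\<in>S. z i *\<^sub>R B $ i) + (\<Sum>i\<in>- S. z i *\<^sub>R B $ i)"
      using sum.union_disjoint[of S "- S"] by simp
    also have "(\<Sum>i\<in>S. z i *\<^sub>R B $ i) = - (\<Sum>j\<in>- S. s j *\<^sub>R (\<Sum>i\<in>S. u j (B $ i) *\<^sub>R B $ i))"
      by (subst scaleR_sum_right, subst sum.swap) (simp add: z_def sum_negf scaleR_sum_left)
    also have "\<dots> = - (\<Sum>j\<in>- S. s j *\<^sub>R B $ j)"
      using u(2) by (simp add: V_def sum.reindex[OF inj] o_def)
    finally show ?thesis by (simp add: z_def)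
  qed
  have "(\<Sum>i\<in>UNIV. g i * z i) = (\<Sum>i\<in>- S. g i * s i)"
    using g(2) by (intro sum.mono_neutral_cong_right) (auto simp: z_def)
  also have "\<dots> = g a * s a + (\<Sum>i\<in>- S - {a}. g i * s i)" using a by (subst sum.remove[of _ a]) auto
  also have "\<dots> = 0" using g(1)[OF a] by (simp add: s_def)
  finally have z3: "(\<Sum>i\<in>UNIV. z i * (norm (B $ i))\<^sup>2) = 0" using g(3)[OF z1 z2] by simp
  show ?thesis
  proof (rule that)
    show "(\<chi> i. z i) \<in> circuit_space B" using z1 z2 z3 by (simp add: mem_circuit_space_iff)
    show "\<And>i. i \<notin> S \<Longrightarrow> i \<noteq> a \<Longrightarrow> (\<chi> i. z i) $ i = t i" by (simp add: z_def s_def)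
  qed
qed

section \<open>Positive dependencies in three-space\<close>

definition det3 :: "(nat \<Rightarrow> nat \<Rightarrow> 'a::comm_ring_1) \<Rightarrow> nat \<Rightarrow> nat \<Rightarrow> nat \<Rightarrow> 'a" where
  "det3 u i j k = u i 0 * (u j 1 * u k 2 - u j 2 * u k 1) - u i 1 * (u j 0 * u k 2 - u j 2 * u k 0)
     + u i 2 * (u j 0 * u k 1 - u j 1 * u k 0)"

text \<open>Vectors of \<open>\<real>\<^sup>3\<close> are families \<open>u i b\<close> with \<open>b < 3\<close>. The
  condition says that the origin lies in the relative interior of the convex hull of the vectors labeled by
  \<open>Z\<close>, if \<open>Z\<close> is not empty.\<close>
definition pos_dep :: "(nat \<Rightarrow> nat \<Rightarrow> real) \<Rightarrow> nat set \<Rightarrow> bool" where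
  "pos_dep u Z \<longleftrightarrow> (\<exists>c. (\<forall>i\<in>Z. c i > 0) \<and> (\<forall>b<3. (\<Sum>i\<in>Z. c i * u i b) = 0))"

lemma all_less_3: "(\<forall>b<3. P b) \<longleftrightarrow> P 0 \<and> P 1 \<and> P (2::nat)"
  by (auto simp: numeral_3_eq_3 less_Suc_eq numeral_2_eq_2)

lemma sum4: "distinct [i,j,k,l] \<Longrightarrow> (\<Sum>n\<in>{i,j,k,l}. f n) = f i + f j + f k + (f l :: 'a::comm_monoid_add)"
  by (simp add: add.assoc)

lemma cramer4: "b < 3 \<Longrightarrow> det3 u j k l * u i b - det3 u i k l * u j b + det3 u i j l * u k b - det3 u i j k * u l b = (0::real)"
proof -
  assume "b < 3"
  hence "b = 0 \<or> b = 1 \<or> b = 2" by auto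
  thus ?thesis by (elim disjE) (simp_all add: det3_def algebra_simps)
qed

text \<open>Elimination of \<open>u k\<close>, \<open>u j\<close> or \<open>u i\<close> from the relation.\<close>
lemma cramer_relation:
  assumes "\<forall>b<3. (c1::real) * u i b + c2 * u j b + c3 * u k b + c4 * u l b = 0"
  shows "c4 * det3 u i j l = - c3 * det3 u i j k" "c4 * det3 u i k l = c2 * det3 u i j k"
    "c4 * det3 u j k l = - c1 * det3 u i j k"
  using assms unfolding all_less_3 det3_def by algebra+

text \<open>By Cramer's rule the coefficients of the dependency between four vectors are their
  \<open>3 \<times> 3\<close> determinants with alternating signs; this is the sign pattern that makes them all
  positive.\<close>
definition circuit_signs :: "(nat \<Rightarrow> nat \<Rightarrow> 'a::linordered_idom) \<Rightarrow> nat \<Rightarrow> nat \<Rightarrow> nat \<Rightarrow> nat \<Rightarrow> bool" where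
  "circuit_signs u i j k l \<longleftrightarrow> (let s = sgn (det3 u i j k) in s \<noteq> 0 \<and> sgn (det3 u i j l) = - s \<and>
     sgn (det3 u i k l) = s \<and> sgn (det3 u j k l) = - s)"

lemma circuit_signs_if_pos_dep:
  assumes "distinct [i,j,k,l]" "pos_dep u {i,j,k,l}" "det3 u i j k \<noteq> 0"
  shows "circuit_signs u i j k l"
proof -
  obtain c where c: "c i > 0" "c j > 0" "c k > 0" "c l > 0"
    and r: "\<forall>b<3. c i * u i b + c j * u j b + c k * u k b + c l * u l b = 0"
    using assms unfolding pos_dep_def sum4[OF assms(1)] by auto
  note rel = cramer_relation[OF r]
  have "sgn (det3 u i j l) = sgn (c l * det3 u i j l)" "sgn (det3 u i k l) = sgn (c l * det3 u i k l)"
    "sgn (det3 u j k l) = sgn (c l * det3 u j k l)" using c by (simp_all add: sgn_mult)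
  thus ?thesis using c assms(3) unfolding rel circuit_signs_def Let_def by (simp add: sgn_mult sgn_eq_0_iff)
qed

lemma pos_dep_if_circuit_signs:
  assumes "distinct [i,j,k,l]" "circuit_signs u i j k l"
  shows "pos_dep u {i,j,k,l}"
proof -
  define s where "s = sgn (det3 u i j k)"
  define c where "c n = (if n = i then - s * det3 u j k l else if n = j then s * det3 u i k l
     else if n = k then - s * det3 u i j l else s * det3 u i j k)" for n
  have sg: "s \<noteq> 0" "sgn (det3 u i j l) = - s" "sgn (det3 u i k l) = s" "sgn (det3 u j k l) = - s"
    "sgn (det3 u i j k) = s"
    using assms(2) by (simp_all add: circuit_signs_def Let_def s_def)
  have "s = 1 \<or> s = -1" using sg(1) by (auto simp: s_def sgn_if)
  hence "\<forall>n\<in>{i,j,k,l}. c n > 0" using sg assms(1)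
    by (auto simp: c_def sgn_if split: if_splits)
  moreover have "\<forall>b<3. (\<Sum>n\<in>{i,j,k,l}. c n * u n b) = 0"
  proof (intro allI impI)
    fix b :: nat assume "b < 3"
    have "(\<Sum>n\<in>{i,j,k,l}. c n * u n b) = - s * (det3 u j k l * u i b - det3 u i k l * u j b + det3 u i j l * u k b - det3 u i j k * u l b)"
      unfolding sum4[OF assms(1)] using assms(1) by (simp add: c_def algebra_simps)
    thus "(\<Sum>n\<in>{i,j,k,l}. c n * u n b) = 0" using cramer4[OF \<open>b < 3\<close>] by simp
  qed
  ultimately show ?thesis unfolding pos_dep_def by blast
qed

definition generic :: "(nat \<Rightarrow> nat \<Rightarrow> real) \<Rightarrow> nat \<Rightarrow> bool" where
  "generic u n \<longleftrightarrow> (\<forall>i<n. \<forall>j<n. \<forall>k<n. distinct [i,j,k] \<longrightarrow> det3 u i j k \<noteq> 0)"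

lemma sorted4: assumes "card J = 4" "J \<subseteq> {..<n::nat}"
  obtains i j k l where "i < j" "j < k" "k < l" "l < n" "J = {i,j,k,l}"
proof -
  have fin: "finite J" using assms(2) finite_subset by blast
  define L where "L = sorted_list_of_set J"
  have L: "length L = 4" "sorted_wrt (<) L" "set L = J"
    using assms fin by (auto simp: L_def)
  then obtain i j k l where "L = [i,j,k,l]"
    by (auto simp: length_Suc_conv eval_nat_numeral)
  with L assms(2) that[of i j k l] show ?thesis by auto
qed

lemma pos_dep_Un:
  assumes "finite X" "finite Y" "pos_dep u X" "pos_dep u Y" shows "pos_dep u (X \<union> Y)"
proof -
  obtain c d where c: "\<forall>i\<in>X. c i > 0" "\<forall>b<3. (\<Sum>i\<in>X. c i * u i b) = 0"
    and d: "\<forall>i\<in>Y. d i > 0" "\<forall>b<3. (\<Sum>i\<in>Y. d i * u i b) = 0" using assms by (auto simp: pos_dep_def)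
  define e where "e i = (if i \<in> X then c i else 0) + (if i \<in> Y then d i else 0)" for i
  have "(\<Sum>i\<in>X \<union> Y. e i * u i b) = (\<Sum>i\<in>X. c i * u i b) + (\<Sum>i\<in>Y. d i * u i b)" for b
  proof -
    have "(\<Sum>i\<in>X \<union> Y. e i * u i b) = (\<Sum>i\<in>X \<union> Y. (if i \<in> X then c i * u i b else 0)) + (\<Sum>i\<in>X \<union> Y. (if i \<in> Y then d i * u i b else 0))"
      unfolding sum.distrib[symmetric] by (intro sum.cong) (auto simp: e_def algebra_simps)
    thus ?thesis using assms by (simp add: sum.If_cases Int_absorb1)
  qed
  moreover have "\<forall>i\<in>X \<union> Y. e i > 0" using c d by (auto simp: e_def intro: add_pos_pos)
  ultimately show ?thesis using c d unfolding pos_dep_def by (intro exI[of _ e]) auto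
qed

lemma pos_dep_UN:
  assumes "finite F" "\<And>J. J \<in> F \<Longrightarrow> finite J \<and> pos_dep u J" shows "pos_dep u (\<Union>F)"
  using assms
proof (induction F)
  case empty
  show ?case by (simp add: pos_dep_def)
next
  case (insert J F)
  thus ?case by (auto intro!: pos_dep_Un)
qed

text \<open>Caratheodory's theorem in conic form: among the ways to write \<open>- u i\<close> as a positive
  combination, one with fewest vectors has at most three of them, for otherwise a dependency between four vectors
  allows a coefficient to be lowered to zero. By genericity it has no fewer than three.\<close>
lemma pos_dep_circuit:
  assumes gen: "generic u n" and n: "3 \<le> n" and Z: "Z \<subseteq> {..<n}" "pos_dep u Z" "i \<in> Z"
  obtains J where "i \<in> J" "J \<subseteq> Z" "card J = 4" "pos_dep u J"
proof -
  define good where "good s \<longleftrightarrow> s \<subseteq> Z - {i} \<and> (\<exists>c. (\<forall>j\<in>s. c j > 0) \<and> (\<forall>b<3. u i b + (\<Sum>j\<in>s. c j * u j b) = 0))" for s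
  have finZ: "finite Z" using Z finite_subset by blast
  have "good (Z - {i})"
  proof -
    obtain c where c: "\<forall>j\<in>Z. c j > 0" "\<forall>b<3. (\<Sum>j\<in>Z. c j * u j b) = 0" using Z by (auto simp: pos_dep_def)
    have "u i b + (\<Sum>j\<in>Z - {i}. c j / c i * u j b) = (\<Sum>j\<in>Z. c j * u j b) / c i" for b
      using Z(3) finZ c(1)[rule_format, OF Z(3)]
      by (simp add: sum.remove[of Z i] add_divide_distrib sum_divide_distrib)
    thus ?thesis unfolding good_def using c Z(3) by (intro conjI exI[of _ "\<lambda>j. c j / c i"]) auto
  qed
  then obtain s where s: "good s" and min: "\<And>s'. good s' \<Longrightarrow> card s \<le> card s'"
    using ex_min_if_finite arg_min_nat_lemma[of good _ card] by metis
  obtain c where sub: "s \<subseteq> Z - {i}" and c: "\<forall>j\<in>s. c j > 0" "\<forall>b<3. u i b + (\<Sum>j\<in>s. c j * u j b) = 0"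
    using s by (auto simp: good_def)
  have fin: "finite s" using sub finZ finite_subset by blast
  have no_dep: False if w: "\<forall>b<3. (\<Sum>j\<in>s. w j * u j b) = 0" "j0 \<in> s" "w j0 > 0" for w j0
  proof -
    define Q where "Q = {j\<in>s. w j > 0}"
    have Q: "finite Q" "Q \<noteq> {}" using fin w by (auto simp: Q_def)
    \<comment> \<open>The largest step along the dependency that keeps the coefficients nonnegative.\<close>
    define t where "t = Min ((\<lambda>j. c j / w j) ` Q)"
    have t_le: "t \<le> c j / w j" if "j \<in> Q" for j using Q that by (simp add: t_def)
    have "t \<in> (\<lambda>j. c j / w j) ` Q" unfolding t_def using Q by (intro Min_in) auto
    then obtain j1 where j1: "j1 \<in> Q" "t = c j1 / w j1" by blast
    have t0: "t > 0" using j1 c by (auto simp: Q_def)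
    define d where "d j = c j - t * w j" for j
    have d0: "d j \<ge> 0" if "j \<in> s" for j
    proof (cases "j \<in> Q")
      case True thus ?thesis using t_le[OF True] by (simp add: d_def Q_def field_simps)
    next
      case False
      hence "t * w j \<le> 0" using that t0 by (simp add: Q_def mult_nonneg_nonpos)
      moreover have "c j > 0" using c(1) that by blast
      ultimately show ?thesis by (simp add: d_def)
    qed
    define s' where "s' = {j\<in>s. d j > 0}"
    have "d j1 = 0" using j1 by (simp add: d_def Q_def)
    hence "s' \<subseteq> s" "j1 \<in> s" "j1 \<notin> s'" using j1 by (auto simp: s'_def Q_def)
    hence "s' \<subset> s" by blast
    hence "card s' < card s" using fin by (simp add: psubset_card_mono)
    moreover have "good s'"
    proof -
      have "(\<Sum>j\<in>s'. d j * u j b) = (\<Sum>j\<in>s. d j * u j b)" for b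
        using fin d0 by (intro sum.mono_neutral_left) (auto simp: s'_def not_less intro!: antisym)
      moreover have "(\<Sum>j\<in>s. d j * u j b) = (\<Sum>j\<in>s. c j * u j b) - t * (\<Sum>j\<in>s. w j * u j b)" for b
        by (simp add: d_def sum_subtractf sum_distrib_left algebra_simps)
      ultimately have "\<forall>b<3. u i b + (\<Sum>j\<in>s'. d j * u j b) = 0" using c w by simp
      thus ?thesis unfolding good_def using sub by (intro conjI exI[of _ d]) (auto simp: s'_def)
    qed
    ultimately show False using min[of s'] by simp
  qed
  have "\<not> 4 \<le> card s"
  proof
    assume "4 \<le> card s"
    then obtain J where J: "J \<subseteq> s" "card J = 4" by (meson obtain_subset_with_card_n)
    obtain a b' k l where abkl: "a < b'" "b' < k" "k < l" "l < n" "J = {a,b',k,l}"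
      using sorted4[OF J(2), of n] J sub Z by blast
    define w where "w j = (if j = a then det3 u b' k l else if j = b' then - det3 u a k l else if j = k then det3 u a b' l
       else if j = l then - det3 u a b' k else 0)" for j
    have dep: "(\<Sum>j\<in>s. w j * u j b) = 0" if "b < 3" for b
    proof -
      have "(\<Sum>j\<in>s. w j * u j b) = (\<Sum>j\<in>{a,b',k,l}. w j * u j b)"
        using J(1) fin abkl(5) by (intro sum.mono_neutral_right) (auto simp: w_def)
      also have "\<dots> = det3 u b' k l * u a b - det3 u a k l * u b' b + det3 u a b' l * u k b - det3 u a b' k * u l b"
        using abkl by (subst sum4) (auto simp: w_def)
      finally show ?thesis using cramer4[OF that] by simp
    qed
    have "l \<in> s" using J(1) abkl(5) by blast
    have "det3 u a b' k \<noteq> 0" using gen abkl unfolding generic_def by auto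
    hence "w l \<noteq> 0" using abkl by (simp add: w_def)
    hence "w l > 0 \<or> - w l > 0" by linarith
    thus False using no_dep[of w l] no_dep[of "\<lambda>j. - w j" l] dep \<open>l \<in> s\<close> by (auto simp: sum_negf)
  qed
  moreover have "\<not> card s < 3"
  proof
    assume lt: "card s < 3"
    have "s \<subseteq> {..<n} - {i}" using sub Z by blast
    moreover have "2 \<le> card ({..<n} - {i})" using n Z by (auto simp: card_Diff_singleton_if)
    ultimately obtain s2 where s2: "s \<subseteq> s2" "s2 \<subseteq> {..<n} - {i}" "card s2 = 2"
      using lt exists_subset_between[of s 2 "{..<n} - {i}"] by auto
    obtain j k where jk: "s2 = {j,k}" "j \<noteq> k" using s2(3) by (auto simp: card_2_iff)
    define e where "e m = (if m \<in> s then c m else 0)" for m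
    have "(\<Sum>m\<in>s. c m * u m b) = (\<Sum>m\<in>{j,k}. e m * u m b)" for b
      unfolding jk(1)[symmetric] using s2(1) jk fin by (intro sum.mono_neutral_cong_left) (auto simp: e_def)
    hence "\<forall>b<3. u i b + e j * u j b + e k * u k b = 0" using c jk by (simp add: add.assoc)
    hence "det3 u i j k = 0" unfolding all_less_3 det3_def by algebra
    moreover have "i < n" "j < n" "k < n" "distinct [i,j,k]" using s2 jk Z by auto
    ultimately show False using gen unfolding generic_def by blast
  qed
  ultimately have "card s = 3" by simp
  show ?thesis
  proof (rule that)
    show "i \<in> insert i s" "insert i s \<subseteq> Z" using sub Z by auto
    have "i \<notin> s" using sub by blast
    thus "card (insert i s) = 4" using \<open>card s = 3\<close> fin by simp
    show "pos_dep u (insert i s)" unfolding pos_dep_def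
      using c fin \<open>i \<notin> s\<close> by (intro exI[of _ "c(i := 1)"]) (auto intro!: trans[OF arg_cong2[of _ _ _ _ "(+)", OF refl sum.cong] c(2)[rule_format]])
  qed
qed

text \<open>Positive dependence of a set is determined by the positive circuits of four vectors inside it, since the
  set is their union.\<close>
lemma pos_dep_cong_circuits:
  assumes gen: "generic u n" and n: "3 \<le> n"
    and circ: "\<And>J. J \<subseteq> {..<n} \<Longrightarrow> card J = 4 \<Longrightarrow> pos_dep u J \<Longrightarrow> pos_dep v J"
    and Z: "Z \<subseteq> {..<n}" "pos_dep u Z"
  shows "pos_dep v Z"
proof -
  define F where "F = {J. J \<subseteq> Z \<and> card J = 4 \<and> pos_dep u J}"
  have finZ: "finite Z" using Z finite_subset by blast
  have "\<Union>F = Z"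
  proof
    show "\<Union>F \<subseteq> Z" by (auto simp: F_def)
    show "Z \<subseteq> \<Union>F"
    proof
      fix i assume "i \<in> Z"
      from pos_dep_circuit[OF gen n Z this] show "i \<in> \<Union>F" unfolding F_def by blast
    qed
  qed
  moreover have "pos_dep v (\<Union>F)"
  proof (rule pos_dep_UN)
    show "finite F" using finZ by (simp add: F_def)
    show "\<And>J. J \<in> F \<Longrightarrow> finite J \<and> pos_dep v J" using circ Z finZ finite_subset by (auto simp: F_def)
  qed
  ultimately show ?thesis by simp
qed

text \<open>The vectors of a positive circuit span \<open>\<real>\<^sup>3\<close>, and adding a large multiple of the
  circuit makes the coefficients of any other expression positive.\<close>
lemma pos_dep_insert:
  assumes gen: "generic u n" and n: "3 \<le> n" and Z: "Z \<subseteq> {..<n}" "pos_dep u Z" "Z \<noteq> {}" and m: "m < n"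
  shows "pos_dep u (insert m Z)"
proof (cases "m \<in> Z")
  case True thus ?thesis using Z by (simp add: insert_absorb)
next
  case False
  obtain z where "z \<in> Z" using Z by blast
  then obtain J where J: "J \<subseteq> Z" "card J = 4" "pos_dep u J" using pos_dep_circuit[OF gen n Z(1,2)] by metis
  obtain i j k l where o: "i < j" "j < k" "k < l" "l < n" "J = {i,j,k,l}" using sorted4[OF J(2), of n] J Z by blast
  obtain c where c: "\<forall>a\<in>J. c a > 0" "\<forall>b<3. (\<Sum>a\<in>J. c a * u a b) = 0" using J(3) by (auto simp: pos_dep_def)
  have D: "det3 u i j k \<noteq> 0" using gen o by (auto simp: generic_def)
  \<comment> \<open>Cramer's rule for \<open>- u m\<close> in the basis \<open>u i, u j, u k\<close>, corrected by a multiple of the circuit.\<close>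
  define e where "e a = (if a = i then - det3 u m j k / det3 u i j k else if a = j then - det3 u i m k / det3 u i j k
     else if a = k then - det3 u i j m / det3 u i j k else 0)" for a
  define t where "t = 1 + (\<Sum>a\<in>J. \<bar>e a\<bar> / c a)"
  have t: "e a + t * c a > 0" if "a \<in> J" for a
  proof -
    have "\<bar>e a\<bar> / c a \<le> (\<Sum>a\<in>J. \<bar>e a\<bar> / c a)" using that c J(2)
      by (intro member_le_sum) (auto intro: card_ge_0_finite less_imp_le)
    hence "\<bar>e a\<bar> / c a < t" by (simp add: t_def)
    hence "\<bar>e a\<bar> < t * c a" using c that by (simp add: field_simps)
    thus ?thesis by linarith
  qed
  have e: "u m b + (\<Sum>a\<in>J. e a * u a b) = 0" if "b < 3" for b
  proof -
    have "(\<Sum>a\<in>J. e a * u a b) = e i * u i b + e j * u j b + e k * u k b"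
      unfolding o(5) using o by (subst sum4) (auto simp: e_def)
    also have "\<dots> = - (det3 u m j k * u i b + det3 u i m k * u j b + det3 u i j m * u k b) / det3 u i j k"
      using o by (simp add: e_def add_divide_distrib[symmetric] diff_divide_distrib[symmetric] field_simps)
    also have "det3 u m j k * u i b + det3 u i m k * u j b + det3 u i j m * u k b = det3 u i j k * u m b"
      using cramer4[OF that, of u j k m i] by (simp add: det3_def algebra_simps)
    finally show ?thesis using D by simp
  qed
  have fJ: "finite J" using J(2) by (simp add: card_ge_0_finite)
  have mJ: "m \<notin> J" using J False by blast
  have "pos_dep u (insert m J)" unfolding pos_dep_def
  proof (intro exI[of _ "\<lambda>a. if a = m then 1 else e a + t * c a"] conjI ballI allI impI)
    fix a assume "a \<in> insert m J" thus "(if a = m then 1 else e a + t * c a) > 0" using t by auto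
  next
    fix b :: nat assume b: "b < 3"
    have "(\<Sum>a\<in>insert m J. (if a = m then 1 else e a + t * c a) * u a b) = u m b + (\<Sum>a\<in>J. (e a + t * c a) * u a b)"
      using fJ mJ by (simp add: sum.insert) (intro sum.cong, auto)
    also have "\<dots> = (u m b + (\<Sum>a\<in>J. e a * u a b)) + t * (\<Sum>a\<in>J. c a * u a b)"
      by (simp add: sum.distrib sum_distrib_left algebra_simps)
    finally show "(\<Sum>a\<in>insert m J. (if a = m then 1 else e a + t * c a) * u a b) = 0" using e[OF b] c b by simp
  qed
  hence "pos_dep u (Z \<union> insert m J)"
    using Z fJ finite_subset by (intro pos_dep_Un) (auto simp: finite_subset)
  moreover have "Z \<union> insert m J = insert m Z" using J by blast
  ultimately show ?thesis by simp
qed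

text \<open>Scaling vectors by positive factors and repeating them does not affect positive dependence: coefficients
  of copies are added up in one direction, and divided evenly in the other.\<close>
lemma pos_dep_scaled_copies:
  assumes pos: "\<And>i. i \<in> Z \<Longrightarrow> r i > 0" and u: "\<And>i b. i \<in> Z \<Longrightarrow> b < 3 \<Longrightarrow> u i b = r i * v (f i) b" and fin: "finite Z"
  shows "pos_dep u Z \<longleftrightarrow> pos_dep v (f ` Z)"
proof
  assume "pos_dep u Z"
  then obtain c where c: "\<forall>i\<in>Z. c i > 0" "\<forall>b<3. (\<Sum>i\<in>Z. c i * u i b) = 0" by (auto simp: pos_dep_def)
  define d where "d k = (\<Sum>i\<in>{i\<in>Z. f i = k}. c i * r i)" for k
  have "d k > 0" if "k \<in> f ` Z" for k unfolding d_def using that c pos fin by (intro sum_pos) auto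
  moreover have "(\<Sum>k\<in>f ` Z. d k * v k b) = 0" if "b < 3" for b
  proof -
    have "(\<Sum>k\<in>f ` Z. d k * v k b) = (\<Sum>k\<in>f ` Z. \<Sum>i\<in>{i\<in>Z. f i = k}. c i * u i b)"
      unfolding d_def sum_distrib_right using u that by (intro sum.cong refl) (auto simp: mult_ac)
    also have "\<dots> = (\<Sum>i\<in>Z. c i * u i b)" using fin by (rule sum.image_gen[symmetric])
    finally show ?thesis using c that by simp
  qed
  ultimately show "pos_dep v (f ` Z)" unfolding pos_dep_def by blast
next
  assume "pos_dep v (f ` Z)"
  then obtain d where d: "\<forall>k\<in>f ` Z. d k > 0" "\<forall>b<3. (\<Sum>k\<in>f ` Z. d k * v k b) = 0" by (auto simp: pos_dep_def)
  define c where "c i = d (f i) / (r i * card {j\<in>Z. f j = f i})" for i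
  have card0: "card {j\<in>Z. f j = f i} > 0" if "i \<in> Z" for i using that fin by (auto simp: card_gt_0_iff)
  have "c i > 0" if "i \<in> Z" for i unfolding c_def using d pos that card0 by simp
  moreover have "(\<Sum>i\<in>Z. c i * u i b) = 0" if "b < 3" for b
  proof -
    have "(\<Sum>i\<in>Z. c i * u i b) = (\<Sum>k\<in>f ` Z. \<Sum>i\<in>{i\<in>Z. f i = k}. c i * u i b)" using fin by (rule sum.image_gen)
    also have "\<dots> = (\<Sum>k\<in>f ` Z. \<Sum>i\<in>{i\<in>Z. f i = k}. d k * v k b / card {j\<in>Z. f j = k})"
    proof (intro sum.cong refl)
      fix k i assume i: "i \<in> {i\<in>Z. f i = k}"
      hence "r i > 0" "u i b = r i * v (f i) b" using pos u that by auto
      thus "c i * u i b = d k * v k b / card {j\<in>Z. f j = k}" using i by (simp add: c_def)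
    qed
    also have "\<dots> = (\<Sum>k\<in>f ` Z. d k * v k b)"
      using card0 by (intro sum.cong refl) (force simp: card_gt_0_iff)
    finally show ?thesis using d that by simp
  qed
  ultimately show "pos_dep u Z" unfolding pos_dep_def by blast
qed

section \<open>Realizing vectors by points\<close>

text \<open>The labels and the coordinate axes are numbered by natural numbers, so that concrete sets of labels can be
  written down.\<close>
definition pt_ix :: "nat \<Rightarrow> 30" where "pt_ix = (SOME f. bij_betw f {..<30} UNIV)"
definition ax_ix :: "nat \<Rightarrow> 25" where "ax_ix = (SOME f. bij_betw f {..<25} UNIV)"

lemma bij_pt_ix: "bij_betw pt_ix {..<30} UNIV"
proof -
  have "\<exists>f. bij_betw f {..<30::nat} (UNIV :: 30 set)"
    using ex_bij_betw_nat_finite[of "UNIV :: 30 set"] by (simp add: atLeast0LessThan)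
  thus ?thesis unfolding pt_ix_def by (rule someI_ex)
qed

lemma bij_ax_ix: "bij_betw ax_ix {..<25} UNIV"
proof -
  have "\<exists>f. bij_betw f {..<25::nat} (UNIV :: 25 set)"
    using ex_bij_betw_nat_finite[of "UNIV :: 25 set"] by (simp add: atLeast0LessThan)
  thus ?thesis unfolding ax_ix_def by (rule someI_ex)
qed

lemma pt_ix_eq_iff: "i < 30 \<Longrightarrow> j < 30 \<Longrightarrow> pt_ix i = pt_ix j \<longleftrightarrow> i = j"
  using bij_pt_ix by (auto simp: bij_betw_def inj_on_def)

lemma pt_ix_cases: obtains k where "k < 30" "i = pt_ix k"
  using bij_pt_ix by (auto simp: bij_betw_def image_iff)

lemma all_pt_ix: "(\<forall>i. P i) \<longleftrightarrow> (\<forall>k<30. P (pt_ix k))"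
proof (intro iffI allI)
  fix i assume "\<forall>k<30. P (pt_ix k)"
  thus "P i" by (cases i rule: pt_ix_cases) auto
qed auto

lemma sum_pt_ix: "(\<Sum>i\<in>UNIV. f i) = (\<Sum>k<30. f (pt_ix k))"
  using sum.reindex_bij_betw[OF bij_pt_ix, of f] by simp

text \<open>The origin and \<open>25\<close> points on the coordinate axes at squared distances \<open>x i\<close>: a
  simplex whose vertices \<open>0, \<dots>, 25\<close> serve as an affine basis.\<close>
definition simplex_pt :: "(nat \<Rightarrow> real) \<Rightarrow> nat \<Rightarrow> real^25" where
  "simplex_pt x i = (if i = 0 then 0 else sqrt (x i) *\<^sub>R axis (ax_ix (i - 1)) 1)"

text \<open>The points \<open>26, 27, 28\<close> turn the columns of \<open>w\<close> into affine dependencies with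
  the simplex; the centroid \<open>29\<close> of the simplex is going to be the apex of the cone.\<close>
definition star_pt :: "(nat \<Rightarrow> nat \<Rightarrow> real) \<Rightarrow> (nat \<Rightarrow> real) \<Rightarrow> nat \<Rightarrow> real^25" where
  "star_pt w x k = (if k < 26 then simplex_pt x k
     else if k < 29 then - (\<Sum>i<26. w i (k - 26) *\<^sub>R simplex_pt x i)
     else (\<Sum>i<26. (1/26) *\<^sub>R simplex_pt x i))"

definition star_config :: "(nat \<Rightarrow> nat \<Rightarrow> real) \<Rightarrow> (nat \<Rightarrow> real) \<Rightarrow> (25, 30) config" where
  "star_config w x = (\<chi> n. star_pt w x (inv_into {..<30} pt_ix n))"

text \<open>The vectors in \<open>\<real>\<^sup>3\<close> dual to the points: the rows of \<open>w\<close> followed by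
  the standard basis.\<close>
definition star_vec :: "(nat \<Rightarrow> nat \<Rightarrow> real) \<Rightarrow> nat \<Rightarrow> nat \<Rightarrow> real" where
  "star_vec w k b = (if k < 26 then w k b else if b = k - 26 then 1 else 0)"

lemma star_config_nth: "k < 30 \<Longrightarrow> star_config w x $ pt_ix k = star_pt w x k"
  using bij_pt_ix by (simp add: star_config_def bij_betw_def)

lemma sum_split_29: "(\<Sum>k<(29::nat). f k) = (\<Sum>i<26. f i) + (f 26 + (f 27 + (f 28 :: 'a::comm_monoid_add)))"
proof -
  have "{..<29::nat} = {..<26} \<union> {26, 27, 28}" by auto
  thus ?thesis by (simp add: sum.union_disjoint ac_simps)
qed

text \<open>With \<open>\<Sum> w i b = - 1\<close> the points \<open>26 + b\<close> are affine combinations of the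
  simplex; the last hypothesis says that this affine relation also holds for the squared norms, hence for every power
  function.\<close>
context
  fixes w :: "nat \<Rightarrow> nat \<Rightarrow> real" and x :: "nat \<Rightarrow> real"
  assumes x0: "x 0 = 0" and xpos: "\<And>i. 0 < i \<Longrightarrow> i < 26 \<Longrightarrow> 0 < x i"
    and wsum: "\<And>b. b < 3 \<Longrightarrow> (\<Sum>i<26. w i b) = -1"
    and wx: "\<And>b. b < 3 \<Longrightarrow> (\<Sum>i<26. x i * (w i b + (w i b)\<^sup>2)) = 0"
begin

lemma simplex_pt_inner: "i < 26 \<Longrightarrow> j < 26 \<Longrightarrow> simplex_pt x i \<bullet> simplex_pt x j = (if i = j then x i else 0)"
proof -
  assume "i < 26" "j < 26"
  moreover have "ax_ix (i - 1) = ax_ix (j - 1) \<longleftrightarrow> i - 1 = j - 1"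
    using bij_ax_ix \<open>i < 26\<close> \<open>j < 26\<close> by (auto simp: bij_betw_def inj_on_def)
  ultimately show ?thesis using x0 xpos[of i]
    by (auto simp: simplex_pt_def inner_axis_axis)
qed

lemma norm_comb: "(norm (\<Sum>i<26. c i *\<^sub>R simplex_pt x i))\<^sup>2 = (\<Sum>i<26. x i * (c i)\<^sup>2)"
proof -
  have "(norm (\<Sum>i<26. c i *\<^sub>R simplex_pt x i))\<^sup>2 =
      (\<Sum>i<26. \<Sum>j<26. c i * (c j * (simplex_pt x i \<bullet> simplex_pt x j)))"
    unfolding power2_norm_eq_inner by (simp add: inner_sum_left inner_sum_right sum_distrib_left inner_commute mult_ac)
  also have "\<dots> = (\<Sum>i<26. \<Sum>j<26. if i = j then x i * (c i)\<^sup>2 else 0)"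
    by (intro sum.cong refl) (auto simp: simplex_pt_inner power2_eq_square)
  finally show ?thesis by simp
qed

lemma star_power_relation:
  assumes "b < 3"
  defines "p \<equiv> \<lambda>c h k. (norm (star_pt w x k))\<^sup>2 - 2 * (c \<bullet> star_pt w x k) + h"
  shows "p c h (26 + b) + (\<Sum>i<26. w i b * p c h i) = 0"
proof -
  define s where "s = (\<Sum>i<26. w i b *\<^sub>R simplex_pt x i)"
  have 1: "p c h (26 + b) = (\<Sum>i<26. x i * (w i b)\<^sup>2) + 2 * (c \<bullet> s) + h"
    using assms(1) norm_comb[of "\<lambda>i. w i b"] by (simp add: p_def star_pt_def s_def)
  have "p c h i = x i - 2 * (c \<bullet> simplex_pt x i) + h" if "i < 26" for i
    using that simplex_pt_inner[of i i] by (simp add: p_def star_pt_def power2_norm_eq_inner)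
  hence "(\<Sum>i<26. w i b * p c h i) = (\<Sum>i<26. w i b * (x i - 2 * (c \<bullet> simplex_pt x i) + h))" by simp
  also have "\<dots> = (\<Sum>i<26. x i * w i b) - 2 * (c \<bullet> s) + (\<Sum>i<26. w i b) * h"
    by (simp add: s_def inner_sum_right sum_subtractf sum.distrib sum_distrib_left sum_distrib_right algebra_simps)
  finally show ?thesis using 1 wsum[OF assms(1)] wx[OF assms(1)] by (simp add: sum.distrib distrib_left)
qed

text \<open>The power at the centroid falls short of the mean power of the simplex by a constant. Rescaling the other
  powers therefore makes it zero or positive at will, which is what makes the whole triangulation a cone over the
  centroid.\<close>
lemma star_power_centre:
  defines "p \<equiv> \<lambda>c h k. (norm (star_pt w x k))\<^sup>2 - 2 * (c \<bullet> star_pt w x k) + h"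
  shows "p c h 29 = (\<Sum>i<26. p c h i) / 26 - (\<Sum>i<26. x i) * (1/26 - 1/26^2)"
proof -
  have "p c h i = x i - 2 * (c \<bullet> simplex_pt x i) + h" if "i < 26" for i
    using that simplex_pt_inner[of i i] by (simp add: p_def star_pt_def power2_norm_eq_inner)
  hence 1: "(\<Sum>i<26. p c h i) = (\<Sum>i<26. x i) - 2 * (\<Sum>i<26. c \<bullet> simplex_pt x i) + 26 * h"
    by (simp add: sum.distrib sum_subtractf sum_distrib_left)
  have "p c h 29 = (\<Sum>i<26. x i) / 26^2 - 2 * (\<Sum>i<26. c \<bullet> simplex_pt x i) / 26 + h"
    using norm_comb[of "\<lambda>i. 1/26"]
    by (simp add: p_def star_pt_def inner_sum_right sum_distrib_left sum_divide_distrib power2_eq_square)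
  thus ?thesis unfolding 1 by (simp add: field_simps)
qed

lemma star_vec_sum: "b < 3 \<Longrightarrow> (\<Sum>k<29. f k * star_vec w k b) = (\<Sum>i<26. f i * w i b) + f (26 + b)"
proof -
  assume "b < 3"
  hence "b = 0 \<or> b = 1 \<or> b = 2" by auto
  thus ?thesis by (elim disjE) (simp_all add: sum_split_29 star_vec_def)
qed

lemma sum_x_pos: "0 < (\<Sum>i<26. x i) * (1/26 - 1/26^2)"
proof -
  have "0 < (\<Sum>i<26. x i)"
  proof (rule sum_pos2[of _ 1])
    fix i :: nat assume "i \<in> {..<26}"
    thus "0 \<le> x i" using x0 xpos[of i] by (cases "i = 0") auto
  qed (use xpos in auto)
  thus ?thesis by simp
qed

text \<open>The values of power functions at the simplex points can be prescribed arbitrarily, and those at the points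
  \<open>26 + b\<close> follow by the relation. So the value vectors on the labels below \<open>29\<close> are exactly
  the dependencies of \<^term>\<open>star_vec w\<close>; nonnegative ones cut out the faces, and the centroid is
  adjusted by rescaling. The zero vector is excluded since then the power at the centroid would be negative.\<close>
lemma lower_face_star_iff:
  "lower_face (star_config w x) S \<longleftrightarrow>
     (let Z = {k. k < 29 \<and> pt_ix k \<notin> S} in Z \<noteq> {} \<and> pos_dep (star_vec w) Z)"
proof -
  define Z where "Z = {k. k < 29 \<and> pt_ix k \<notin> S}"
  define p where "p c h k = (norm (star_pt w x k))\<^sup>2 - 2 * (c \<bullet> star_pt w x k) + h" for c h k
  define kap where "kap = (\<Sum>i<26. x i) * (1/26 - 1/26^2)"
  have kap: "0 < kap" using sum_x_pos by (simp add: kap_def)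
  have rel: "p c h (26 + b) + (\<Sum>i<26. w i b * p c h i) = 0" if "b < 3" for b c h
    using star_power_relation[OF that, of c h] by (simp add: p_def)
  have cen: "p c h 29 = (\<Sum>i<26. p c h i) / 26 - kap" for c h
    using star_power_centre[of c h] by (simp add: p_def kap_def)
  have lf: "lower_face (star_config w x) S \<longleftrightarrow>
      (\<exists>c h. \<forall>k<30. (pt_ix k \<in> S \<longrightarrow> p c h k = 0) \<and> (pt_ix k \<notin> S \<longrightarrow> p c h k > 0))"
  proof -
    have "(\<forall>i\<in>S. q i = 0) \<and> (\<forall>i. i \<notin> S \<longrightarrow> q i > 0) \<longleftrightarrow>
        (\<forall>k<30. (pt_ix k \<in> S \<longrightarrow> q (pt_ix k) = 0) \<and> (pt_ix k \<notin> S \<longrightarrow> q (pt_ix k) > 0))" for q :: "30 \<Rightarrow> real"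
      using all_pt_ix[of "\<lambda>i. (i \<in> S \<longrightarrow> q i = 0) \<and> (i \<notin> S \<longrightarrow> q i > 0)"] by blast
    thus ?thesis unfolding lower_face_def p_def by (simp add: star_config_nth)
  qed
  have ZZ: "(\<Sum>k\<in>Z. g k) = (\<Sum>k<29. if pt_ix k \<notin> S then g k else 0)" for g :: "nat \<Rightarrow> real"
    by (rule sum.mono_neutral_cong_left) (auto simp: Z_def)
  show ?thesis unfolding Let_def Z_def[symmetric]
  proof
    assume "lower_face (star_config w x) S"
    then obtain c h where ch: "\<And>k. k < 30 \<Longrightarrow> pt_ix k \<in> S \<Longrightarrow> p c h k = 0"
        "\<And>k. k < 30 \<Longrightarrow> pt_ix k \<notin> S \<Longrightarrow> p c h k > 0" using lf by blast
    have "pos_dep (star_vec w) Z" unfolding pos_dep_def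
    proof (intro exI[of _ "p c h"] conjI ballI allI impI)
      fix i assume "i \<in> Z" thus "p c h i > 0" using ch(2)[of i] by (simp add: Z_def)
    next
      fix b :: nat assume b: "b < 3"
      have "(\<Sum>k\<in>Z. p c h k * star_vec w k b) = (\<Sum>k<29. p c h k * star_vec w k b)"
        unfolding ZZ using ch(1) by (intro sum.cong) auto
      thus "(\<Sum>k\<in>Z. p c h k * star_vec w k b) = 0"
        unfolding star_vec_sum[OF b] using rel[OF b, of c h] by (simp add: mult.commute)
    qed
    moreover have "Z \<noteq> {}"
    proof
      assume "Z = {}"
      hence "p c h i = 0" if "i < 26" for i using that ch(1)[of i] by (auto simp: Z_def)
      hence "p c h 29 < 0" using cen[of c h] kap by simp
      moreover have "0 \<le> p c h 29" using ch[of 29] by (cases "pt_ix 29 \<in> S") auto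
      ultimately show False by simp
    qed
    ultimately show "Z \<noteq> {} \<and> pos_dep (star_vec w) Z" by blast
  next
    assume A: "Z \<noteq> {} \<and> pos_dep (star_vec w) Z"
    then obtain f where f: "\<forall>k\<in>Z. f k > 0" "\<forall>b<3. (\<Sum>k\<in>Z. f k * star_vec w k b) = 0" by (auto simp: pos_dep_def)
    define g where "g k = (if k \<in> Z then f k else 0)" for k
    have g: "g (26 + b) = - (\<Sum>i<26. w i b * g i)" if "b < 3" for b
    proof -
      have "(\<Sum>k\<in>Z. f k * star_vec w k b) = (\<Sum>k<29. g k * star_vec w k b)"
        unfolding ZZ by (intro sum.cong) (auto simp: g_def Z_def)
      thus ?thesis using f that star_vec_sum[OF that, of g] by (simp add: mult.commute)
    qed
    have g0: "0 \<le> g k" for k using f by (auto simp: g_def less_imp_le)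
    have G: "0 < (\<Sum>i<26. g i)"
    proof (rule ccontr)
      assume "\<not> ?thesis"
      moreover have "0 \<le> (\<Sum>i<26. g i)" using g0 by (intro sum_nonneg)
      ultimately have "(\<Sum>i<26. g i) = 0" by linarith
      hence "\<forall>i\<in>{..<26}. g i = 0" using g0 by (subst (asm) sum_nonneg_eq_0_iff) auto
      hence "g i = 0" if "i < 26" for i using that by simp
      moreover from this g have "g (26 + b) = 0" if "b < 3" for b using that by simp
      ultimately have "g k = 0" if "k < 29" for k
      proof (cases "k < 26")
        case False
        hence "k = 26 + (k - 26)" "k - 26 < 3" using that by auto
        thus ?thesis using \<open>\<And>b. b < 3 \<Longrightarrow> g (26 + b) = 0\<close>[of "k - 26"] by simp
      qed (use \<open>\<And>i. i < 26 \<Longrightarrow> g i = 0\<close> in auto)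
      note g29 = this
      obtain k where "k \<in> Z" using A by blast
      hence "f k > 0" "g k = f k" "k < 29" using f by (auto simp: g_def Z_def)
      with g29[of k] show False by simp
    qed
    \<comment> \<open>This factor puts the power of the centroid at \<open>0\<close> or at \<open>kap / 26\<close>.\<close>
    define r where "r = (if pt_ix 29 \<in> S then 26 * kap else 27 * kap) / (\<Sum>i<26. g i)"
    have r: "0 < r" using kap G by (simp add: r_def)
    define h where "h = r * g 0"
    \<comment> \<open>The axis points are orthogonal, so each coordinate of the centre fixes the power at one of them.\<close>
    define c where "c = (\<Sum>i\<in>{1..<26}. ((x i + h - r * g i) / (2 * sqrt (x i))) *\<^sub>R (axis (ax_ix (i - 1)) 1 :: real^25))"
    have pi: "p c h i = r * g i" if "i < 26" for i
    proof (cases "i = 0")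
      case True
      thus ?thesis by (simp add: p_def star_pt_def simplex_pt_def h_def)
    next
      case False
      have "c \<bullet> simplex_pt x i = (\<Sum>j\<in>{1..<26}. if j = i then (x i + h - r * g i) / 2 else 0)"
        unfolding c_def inner_sum_left
      proof (intro sum.cong refl)
        fix j assume j: "j \<in> {1..<26::nat}"
        have "ax_ix (j - 1) = ax_ix (i - 1) \<longleftrightarrow> j - 1 = i - 1"
          using bij_ax_ix j that by (auto simp: bij_betw_def inj_on_def)
        also have "\<dots> \<longleftrightarrow> j = i" using j False by auto
        finally have "ax_ix (j - 1) = ax_ix (i - 1) \<longleftrightarrow> j = i" .
        thus "((x j + h - r * g j) / (2 * sqrt (x j))) *\<^sub>R axis (ax_ix (j - 1)) 1 \<bullet> simplex_pt x i =
            (if j = i then (x i + h - r * g i) / 2 else 0)"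
          using False xpos[of i] that by (simp add: simplex_pt_def inner_axis_axis)
      qed
      also have "\<dots> = (x i + h - r * g i) / 2" using that False by simp
      finally show ?thesis using that simplex_pt_inner[of i i] by (simp add: p_def star_pt_def power2_norm_eq_inner)
    qed
    have pb: "p c h (26 + b) = r * g (26 + b)" if "b < 3" for b
      using rel[OF that, of c h] g[OF that] pi by (simp add: sum_distrib_left mult_ac)
    have pk: "p c h k = r * g k" if "k < 29" for k
    proof (cases "k < 26")
      case False
      hence "k = 26 + (k - 26)" "k - 26 < 3" using that by auto
      thus ?thesis using pb[of "k - 26"] by simp
    qed (use pi in auto)
    have p29: "p c h 29 = (if pt_ix 29 \<in> S then 0 else kap / 26)"
    proof -
      have "(\<Sum>i<26. p c h i) = r * (\<Sum>i<26. g i)" by (simp add: pi sum_distrib_left)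
      also have "\<dots> = (if pt_ix 29 \<in> S then 26 * kap else 27 * kap)" using G by (simp add: r_def)
      finally show ?thesis unfolding cen by simp
    qed
    show "lower_face (star_config w x) S" unfolding lf
    proof (intro exI[of _ c] exI[of _ h] allI impI conjI)
      fix k :: nat assume k: "k < 30"
      have *: "(pt_ix k \<in> S \<longrightarrow> p c h k = 0) \<and> (pt_ix k \<notin> S \<longrightarrow> 0 < p c h k)"
      proof (cases "k < 29")
        case True
        hence "k \<in> Z \<longleftrightarrow> pt_ix k \<notin> S" by (simp add: Z_def)
        thus ?thesis using pk[OF True] r f(1) by (simp add: g_def)
      next
        case False
        hence "k = 29" using k by simp
        thus ?thesis using p29 kap by simp
      qed
      { assume "pt_ix k \<in> S" thus "p c h k = 0" using * by blast }
      { assume "pt_ix k \<notin> S" thus "0 < p c h k" using * by blast }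
    qed
  qed
qed

text \<open>Each coordinate of \<^term>\<open>star_vec w\<close>, extended by \<open>0\<close> at the centroid,
  annihilates all power functions and is therefore a circuit.\<close>
lemma star_circuit_space:
  assumes "b < 3"
  shows "(\<chi> n. let k = inv_into {..<30} pt_ix n in if k < 29 then star_vec w k b else 0) \<in> circuit_space (star_config w x)"
    (is "?y \<in> _")
proof -
  have y: "?y $ pt_ix k = (if k < 29 then star_vec w k b else 0)" if "k < 30" for k
    using that bij_pt_ix by (simp add: bij_betw_def)
  have rel: "(\<Sum>j\<in>UNIV. ?y $ j * ((norm (star_config w x $ j))\<^sup>2 - 2 * (c \<bullet> star_config w x $ j) + h)) = 0" for c h
  proof -
    define p where "p k = (norm (star_pt w x k))\<^sup>2 - 2 * (c \<bullet> star_pt w x k) + h" for k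
    have "(\<Sum>j\<in>UNIV. ?y $ j * ((norm (star_config w x $ j))\<^sup>2 - 2 * (c \<bullet> star_config w x $ j) + h)) =
        (\<Sum>k<30. (if k < 29 then star_vec w k b else 0) * p k)"
      unfolding sum_pt_ix by (intro sum.cong refl) (simp add: y star_config_nth p_def del: vec_lambda_beta)
    also have "\<dots> = (\<Sum>k<29. p k * star_vec w k b)"
      by (rule sum.mono_neutral_cong_right) auto
    also have "\<dots> = 0"
      unfolding star_vec_sum[OF assms] using star_power_relation[OF assms, of c h] by (simp add: p_def mult.commute)
    finally show ?thesis .
  qed
  have "(\<Sum>j\<in>UNIV. ?y $ j) = (\<Sum>j\<in>UNIV. ?y $ j * ((norm (star_config w x $ j))\<^sup>2 - 2 * (0 \<bullet> star_config w x $ j) + 1))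
      - (\<Sum>j\<in>UNIV. ?y $ j * ((norm (star_config w x $ j))\<^sup>2 - 2 * (0 \<bullet> star_config w x $ j) + 0))"
    unfolding sum_subtractf[symmetric] by (simp add: algebra_simps del: vec_lambda_beta)
  hence "(\<Sum>j\<in>UNIV. ?y $ j) = 0" unfolding rel by simp
  moreover have "(\<Sum>j\<in>UNIV. ?y $ j * (dist (star_config w x $ i) (star_config w x $ j))\<^sup>2) = 0" for i
    using rel[of "star_config w x $ i" "(norm (star_config w x $ i))\<^sup>2"] power_expand[of "star_config w x $ i" _ 0]
    by simp
  ultimately show ?thesis unfolding circuit_space_def by blast
qed

end

section \<open>Intercepts of lines and hyperbolas\<close>

text \<open>Twice the signed area of the triangle.\<close>
definition orient :: "real \<times> real \<Rightarrow> real \<times> real \<Rightarrow> real \<times> real \<Rightarrow> real" where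
  "orient a b c = (fst b - fst a) * (snd c - snd a) - (snd b - snd a) * (fst c - fst a)"

text \<open>All lines to be considered fall from left to right, so the slope is taken with the opposite sign.\<close>
definition steep :: "real \<times> real \<Rightarrow> real \<times> real \<Rightarrow> real" where
  "steep a b = (snd b - snd a) / (fst a - fst b)"

definition yicpt :: "real \<times> real \<Rightarrow> real \<times> real \<Rightarrow> real" where
  "yicpt a b = snd a + steep a b * fst a"

lemma steep_mult: "fst b < fst a \<Longrightarrow> steep a b * (fst a - fst b) = snd b - snd a"
  by (simp add: steep_def)

lemma yicpt_alt: "fst b < fst a \<Longrightarrow> yicpt a b = snd b + steep a b * fst b"
  using steep_mult[of b a] by (simp add: yicpt_def algebra_simps)

text \<open>For a falling line of steepness \<open>S\<close> and \<open>y\<close>-intercept \<open>q\<close> the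
  product of the two intercepts is \<open>q\<^sup>2 / S\<close>. The secant \<open>d3 d2\<close> is compared with
  \<open>c3 c2\<close> through the line \<open>c3 d2\<close> of intermediate steepness \<open>R\<close>: one of its
  intercepts bounds that of \<open>d3 d2\<close> from above and the other bounds that of \<open>c3 c2\<close> from
  below. The point \<open>w\<close> is a witness, in terms of orientations alone, that \<open>c2\<close> lies above
  the line through \<open>d3\<close> of steepness \<open>R\<close>; this supplies the remaining comparison.\<close>
lemma icpt_product_mono:
  assumes neg: "snd c3 < 0" "snd d3 < 0" and pos: "0 < fst c2" "0 < fst d2" "0 < snd d2"
    and ord: "fst d2 < fst c3" "fst c2 < fst c3" "fst c3 < fst d3" "fst d3 < fst w"
    and st1: "orient c3 d2 c2 < 0" and st2: "orient d2 c3 d3 > 0"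
    and w: "orient w c3 d2 > 0" "orient w d3 c2 < 0" "orient c3 d3 w < 0"
  shows "0 < steep c3 c2" "0 < steep d3 d2" "0 < yicpt d3 d2" "0 < yicpt c3 c2"
    "yicpt d3 d2 ^ 2 / steep d3 d2 \<le> yicpt c3 c2 ^ 2 / steep c3 c2"
proof -
  define S where "S = steep c3 c2"
  define R where "R = steep c3 d2"
  define T where "T = steep d3 d2"
  define V where "V = steep w c3"
  define W where "W = steep w d3"
  have S: "S * (fst c3 - fst c2) = snd c2 - snd c3"
    and R: "R * (fst c3 - fst d2) = snd d2 - snd c3"
    and T: "T * (fst d3 - fst d2) = snd d2 - snd d3"
    and V: "V * (fst w - fst c3) = snd c3 - snd w"
    and W: "W * (fst w - fst d3) = snd d3 - snd w"
    unfolding S_def R_def T_def V_def W_def using ord by (auto intro!: steep_mult)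
  have T0: "0 < T" and R0: "0 < R"
    unfolding T_def R_def steep_def using neg pos ord by auto
  have RS: "R < S"
  proof -
    have "orient c3 d2 c2 = (fst c3 - fst d2) * (fst c3 - fst c2) * (R - S)"
      unfolding orient_def using S R by algebra
    with st1 ord show ?thesis by (simp add: mult_less_0_iff zero_less_mult_iff)
  qed
  have TR: "T < R"
  proof -
    have "orient d2 c3 d3 = (fst d3 - fst d2) * (fst c3 - fst d2) * (R - T)"
      unfolding orient_def using T R by algebra
    moreover have "0 < (fst d3 - fst d2) * (fst c3 - fst d2)" using ord by simp
    ultimately show ?thesis using st2 zero_less_mult_pos by fastforce
  qed
  have RV: "R < V"
  proof -
    have "orient w c3 d2 = (fst w - fst c3) * (fst c3 - fst d2) * (V - R)"
      unfolding orient_def using V R by algebra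
    moreover have "0 < (fst w - fst c3) * (fst c3 - fst d2)" using ord by simp
    ultimately show ?thesis using w(1) zero_less_mult_pos by fastforce
  qed
  have VW: "V < W"
  proof -
    have "orient c3 d3 w = (fst d3 - fst c3) * (fst w - fst c3) * U"
      if "U * (fst d3 - fst c3) = - V * (fst d3 - fst c3) - (snd d3 - snd c3)" for U
      unfolding orient_def using V that by algebra
    moreover define U where "U = - V - (snd d3 - snd c3) / (fst d3 - fst c3)"
    moreover have "U * (fst d3 - fst c3) = - V * (fst d3 - fst c3) - (snd d3 - snd c3)"
      using ord unfolding U_def by (simp add: field_simps)
    ultimately have "U < 0" using w(3) ord
      by (simp add: mult_less_0_iff zero_less_mult_iff)
    moreover have "(V - W) * (fst w - fst d3) = U * (fst d3 - fst c3)"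
      using V W \<open>U * (fst d3 - fst c3) = _\<close> by algebra
    ultimately have "(V - W) * (fst w - fst d3) < 0" using ord by (simp add: mult_less_0_iff)
    with ord show ?thesis by (simp add: mult_less_0_iff)
  qed
  have above: "snd d3 + W * (fst d3 - fst c2) < snd c2"
  proof -
    have "orient w d3 c2 = (fst w - fst d3) * (snd d3 + W * (fst d3 - fst c2) - snd c2)"
      unfolding orient_def using W by algebra
    with w(2) ord show ?thesis by (simp add: mult_less_0_iff)
  qed
  have Qs: "yicpt c3 c2 = snd c2 + S * fst c2" and Qt: "yicpt d3 d2 = snd d2 + T * fst d2"
    unfolding S_def T_def using ord by (auto intro!: yicpt_alt)
  \<comment> \<open>\<open>p\<close> and \<open>pt\<close> are the horizontal intercepts.\<close>
  define p where "p = fst c3 + snd c3 / S"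
  define pr where "pr = fst c3 + snd c3 / R"
  define pt where "pt = fst d3 + snd d3 / T"
  have S0: "0 < S" using R0 RS by simp
  have Qp: "yicpt c3 c2 = S * p" using S0 by (simp add: p_def yicpt_def S_def algebra_simps)
  have Qpt: "yicpt d3 d2 = T * pt" using T0 by (simp add: pt_def yicpt_def T_def algebra_simps)
  have Qpr: "snd d2 + R * fst d2 = R * pr" using R0 R by (simp add: pr_def algebra_simps)
  show 1: "0 < yicpt d3 d2" using Qt pos T0 by (simp add: add_pos_pos)
  have pt0: "0 < pt" using 1 Qpt T0 by (simp add: zero_less_mult_iff)
  have "snd c3 / R \<le> snd c3 / S" using neg R0 RS by (simp add: field_simps)
  hence a: "pr \<le> p" by (simp add: p_def pr_def)
  have "T * fst d2 \<le> R * fst d2" using TR pos by simp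
  hence b: "T * pt \<le> R * pr" using Qt Qpt Qpr by linarith
  have c: "R * pt \<le> S * p"
  proof -
    have "snd d3 / T \<le> snd d3 / R" using neg T0 TR by (simp add: field_simps)
    hence "R * pt \<le> R * (fst d3 + snd d3 / R)" using R0 by (simp add: pt_def)
    also have "\<dots> = R * fst d3 + snd d3" using R0 by (simp add: algebra_simps)
    also have "\<dots> = snd d3 + R * (fst d3 - fst c2) + R * fst c2" by (simp add: algebra_simps)
    also have "\<dots> \<le> snd d3 + W * (fst d3 - fst c2) + S * fst c2"
      using RV VW RS ord pos by (intro add_mono mult_right_mono) auto
    also have "\<dots> \<le> snd c2 + S * fst c2" using above by simp
    finally show ?thesis using Qs Qp by simp
  qed
  have pr0: "0 < pr" using b T0 pt0 R0 by (smt (verit) mult_pos_pos zero_less_mult_pos)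
  show "0 < yicpt c3 c2" using a pr0 S0 by (simp add: Qp)
  have "(T * pt) * (R * pt) \<le> (R * pr) * (S * p)"
    using T0 R0 pt0 pr0 by (intro mult_mono[OF b c]) auto
  hence "R * (T * pt ^ 2) \<le> R * (S * (pr * p))" by (simp add: power2_eq_square mult_ac)
  hence "T * pt ^ 2 \<le> S * (pr * p)" using R0 by simp
  also have "\<dots> \<le> S * p ^ 2" using a S0 pr0 by (simp add: power2_eq_square)
  finally show "yicpt d3 d2 ^ 2 / steep d3 d2 \<le> yicpt c3 c2 ^ 2 / steep c3 c2"
    using S0 T0 unfolding Qp Qpt S_def[symmetric] T_def[symmetric]
    by (simp add: power_mult_distrib power2_eq_square mult_ac)
  show "0 < steep c3 c2" "0 < steep d3 d2" using S0 T0 by (simp_all add: S_def T_def)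
qed

text \<open>Write \<open>a, b\<close> for the coordinates of \<open>p1\<close> and \<open>c, d\<close> for those of
  \<open>p2\<close>. A line with product of intercepts \<open>\<pi>\<close> touches the hyperbola
  \<open>x y = \<pi> / 4\<close>. As \<open>h\<close> is below the line \<open>d3 d2\<close>, so is
  \<open>(c, b)\<close>, and therefore \<open>4 b c\<close> is less than the product of intercepts of
  \<open>d3 d2\<close>. As \<open>n\<close> is above the line \<open>c3 c2\<close>, so is \<open>(a, d)\<close>.
  Equality in the conclusion would say that \<open>d / a\<close> is the steepness of that line, so that
  \<open>(a, d)\<close> is the midpoint of the intercepts of a parallel line further out; the product of intercepts of
  \<open>c3 c2\<close> would then be less than \<open>4 a d\<close>. Together with \<open>a d < b c\<close> this
  contradicts the comparison of the two products.\<close>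
lemma secant_hyperbola_caps:
  assumes c: "fst c2 < fst c3" "0 < steep c3 c2" and d: "fst d2 < fst d3" "0 < steep d3 d2"
    and icpt: "0 < yicpt d3 d2" "0 < yicpt c3 c2"
      "yicpt d3 d2 ^ 2 / steep d3 d2 \<le> yicpt c3 c2 ^ 2 / steep c3 c2"
    and p1: "0 < fst p1" "0 < snd p1" and p2: "0 < fst p2"
    and n: "orient c3 c2 n < 0" "fst n < fst p1" "snd n < snd p2"
    and h: "orient d3 d2 h > 0" "snd p1 < snd h" "fst p2 < fst h"
    and prod: "fst p1 * snd p2 < snd p1 * fst p2"
  shows "fst p1 * (snd c2 - snd c3) \<noteq> snd p2 * (fst c3 - fst c2)"
proof
  assume eq: "fst p1 * (snd c2 - snd c3) = snd p2 * (fst c3 - fst c2)"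
  define S where "S = steep c3 c2"
  define T where "T = steep d3 d2"
  define q where "q = yicpt c3 c2"
  define r where "r = yicpt d3 d2"
  have S: "S * (fst c3 - fst c2) = snd c2 - snd c3" and T: "T * (fst d3 - fst d2) = snd d2 - snd d3"
    unfolding S_def T_def using c d by (auto intro!: steep_mult)
  have S0: "0 < S" and T0: "0 < T" and r0: "0 < r" using c d icpt by (auto simp: S_def T_def r_def)
  have q': "q = snd c3 + S * fst c3" and r': "r = snd d3 + T * fst d3"
    by (auto simp: q_def r_def yicpt_def S_def T_def)
  have "fst p1 * S * (fst c3 - fst c2) = snd p2 * (fst c3 - fst c2)" using eq S by (simp add: mult.assoc)
  hence eq': "snd p2 = S * fst p1" using c by (simp add: mult.commute)
  have "orient c3 c2 n = (fst c3 - fst c2) * (q - snd n - S * fst n)"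
    unfolding orient_def q' using S by algebra
  hence "q < snd n + S * fst n" using n c by (simp add: mult_less_0_iff)
  also have "\<dots> \<le> snd p2 + S * fst p1" using n S0 by (intro add_mono mult_left_mono) auto
  finally have qq: "q < 2 * (S * fst p1)" using eq' by simp
  have "orient d3 d2 h = (fst d3 - fst d2) * (r - snd h - T * fst h)"
    unfolding orient_def r' using T by algebra
  hence "snd h + T * fst h < r" using h d by (simp add: zero_less_mult_iff)
  moreover have "snd p1 + T * fst p2 \<le> snd h + T * fst h"
    using h T0 by (intro add_mono mult_left_mono) auto
  ultimately have rr: "snd p1 + T * fst p2 < r" by simp
  have "4 * T * (snd p1 * fst p2) \<le> (snd p1 + T * fst p2)\<^sup>2"
    using zero_le_power2[of "snd p1 - T * fst p2"] by (simp add: power2_eq_square algebra_simps)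
  also have "\<dots> < r\<^sup>2" using rr p1 p2 T0 by (intro power_strict_mono) auto
  finally have A: "4 * (snd p1 * fst p2) < r\<^sup>2 / T" using T0 by (simp add: field_simps)
  have r2: "r\<^sup>2 / T \<le> q\<^sup>2 / S" using icpt by (simp add: q_def r_def S_def T_def)
  have "q\<^sup>2 \<le> (2 * (S * fst p1))\<^sup>2" using qq icpt by (intro power_mono) (auto simp: q_def)
  hence "q\<^sup>2 / S \<le> 4 * (S * (fst p1)\<^sup>2)" using S0 by (simp add: field_simps power2_eq_square)
  hence "4 * (snd p1 * fst p2) < 4 * (fst p1 * snd p2)" using A r2 eq' by (simp add: power2_eq_square mult_ac)
  thus False using prod by simp
qed

section \<open>Two vector configurations with the same positive circuits\<close>

text \<open>Only \<open>15\<close> of the vectors occur in the planar argument. Vectors \<open>0, 1, 2\<close> are the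
  projective frame; \<open>3\<close> and \<open>4\<close> are the points \<open>h\<close> and \<open>n\<close>,
  \<open>5\<close> and \<open>6\<close> the points \<open>p1\<close> and \<open>p2\<close> of
  \<open>secant_hyperbola_caps\<close>; the pairs \<open>8, 7\<close>, then \<open>10, 9\<close>, then
  \<open>12, 11\<close> span the three secants compared in two steps, with the auxiliary points \<open>13\<close> and
  \<open>14\<close>. Some of them are replaced by their negatives, and vectors \<open>15, \<dots>, 20\<close> are
  added, in order that enough brackets take part in positive circuits.\<close>
definition plus_list :: "(int \<times> int \<times> int) list" where
  "plus_list = [(1, 0, 0), (0, 1, 0), (0, 0, 1), (-1, 1, 1), (-5, 93, 22), (23, -100, -101),
    (100, -428, -101), (1, -4625, -376), (157, 1, -460), (-1, 1173, 289), (-255, -1, 251), (1, -253, -126),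
    (304, 1, -151), (2020, 24280, -1), (-1020, -2040, 1), (-1500, -3, -1), (26, 50, -1), (-2022, -24282, 1),
    (-31, -89, 136), (-625, 2714, 2575), (-4205, -39360, 2729)]"

definition minus_list :: "(int \<times> int \<times> int) list" where
  "minus_list = [(1, 0, 0), (0, 1, 0), (0, 0, 1), (-1, 1, 1), (-2, 141, 17), (13, -109, -110),
    (107, -897, -108), (1, -4625, -376), (157, 1, -460), (-1, 1173, 289), (-255, -1, 251), (1, -253, -126),
    (304, 1, -151), (2020, 24280, -1), (-1020, -2040, 1), (-1500, -3, -1), (26, 50, -1), (-2021, -24282, 1),
    (-11, -34, 93), (-367, 3077, 2307), (-3582, -33674, 2289)]"

text \<open>Positive circuits, each sharing three of its vectors with an earlier one or with the frame
  \<open>0, 1, 2\<close>.\<close>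
definition circuit_chain :: "(nat \<times> nat \<times> nat \<times> nat) list" where
  "circuit_chain = [(0, 1, 2, 15), (0, 1, 3, 15), (0, 3, 5, 15), (0, 1, 3, 6), (0, 1, 3, 7), (0, 1, 6, 10),
    (0, 1, 8, 10), (0, 1, 8, 14), (0, 2, 8, 10), (0, 1, 10, 11), (0, 1, 12, 14), (0, 1, 4, 7),
    (1, 10, 12, 14), (0, 1, 7, 9), (1, 7, 8, 9), (1, 2, 5, 15), (4, 7, 8, 9), (0, 2, 3, 5), (1, 2, 4, 7),
    (9, 10, 12, 14), (9, 10, 11, 12), (1, 2, 7, 9), (1, 2, 6, 15), (7, 8, 9, 10), (3, 9, 11, 12),
    (7, 8, 10, 13), (0, 2, 9, 15), (0, 1, 5, 14), (1, 2, 11, 15), (1, 7, 10, 13), (0, 2, 12, 15),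
    (1, 6, 9, 10), (1, 4, 6, 15), (0, 4, 6, 15), (0, 1, 7, 17), (0, 1, 13, 17), (0, 2, 4, 15), (0, 2, 4, 11),
    (7, 8, 13, 20), (8, 9, 13, 20), (10, 11, 12, 16), (10, 11, 14, 16), (0, 1, 5, 18), (1, 4, 5, 18),
    (0, 2, 5, 19), (2, 5, 6, 19)]"

text \<open>The signs of determinants on which the planar argument relies.\<close>
definition brackets :: "(nat \<times> nat \<times> nat \<times> int) list" where
  "brackets = [(0, 1, 3, 1), (0, 1, 4, 1), (0, 1, 5, -1), (0, 1, 6, -1), (0, 1, 7, -1), (0, 1, 8, -1),
    (0, 1, 9, 1), (0, 1, 10, 1), (0, 1, 11, -1), (0, 1, 12, -1), (0, 1, 13, -1), (0, 1, 14, 1), (1, 2, 5, 1),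
    (0, 2, 5, 1), (1, 2, 6, 1), (0, 2, 11, 1), (0, 2, 9, -1), (0, 2, 8, -1), (0, 2, 10, 1), (0, 2, 12, -1),
    (1, 2, 7, 1), (1, 2, 9, -1), (1, 2, 11, 1), (1, 4, 5, 1), (0, 4, 6, 1), (0, 3, 5, -1), (1, 3, 6, -1),
    (2, 5, 6, 1), (4, 7, 8, -1), (3, 11, 12, 1), (1, 8, 9, -1), (1, 7, 8, -1), (1, 8, 10, 1), (1, 10, 13, 1),
    (7, 8, 9, 1), (8, 9, 10, -1), (8, 9, 13, -1), (7, 10, 13, -1), (8, 10, 13, 1), (1, 10, 11, -1),
    (1, 9, 10, -1), (1, 10, 12, 1), (1, 12, 14, 1), (9, 10, 11, -1), (10, 11, 12, 1), (10, 11, 14, 1),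
    (9, 12, 14, 1), (10, 12, 14, -1)]"

fun det_of :: "int \<times> int \<times> int \<Rightarrow> int \<times> int \<times> int \<Rightarrow> int \<times> int \<times> int \<Rightarrow> int" where
  "det_of (a0,a1,a2) (b0,b1,b2) (c0,c1,c2) =
     a0 * (b1 * c2 - b2 * c1) - a1 * (b0 * c2 - b2 * c0) + a2 * (b0 * c1 - b1 * c0)"

definition vec_of :: "(int \<times> int \<times> int) list \<Rightarrow> nat \<Rightarrow> nat \<Rightarrow> real" where
  "vec_of L i b = (case L ! i of (x, y, z) \<Rightarrow> of_int (if b = 0 then x else if b = 1 then y else z))"

lemma det3_vec_of: "det3 (vec_of L) i j k = of_int (det_of (L ! i) (L ! j) (L ! k))"
  by (cases "L ! i"; cases "L ! j"; cases "L ! k") (simp add: det3_def vec_of_def)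

fun triplewise :: "('a \<Rightarrow> 'a \<Rightarrow> 'a \<Rightarrow> bool) \<Rightarrow> 'a list \<Rightarrow> bool" where
  "triplewise P [] \<longleftrightarrow> True"
| "triplewise P (x # xs) \<longleftrightarrow> sorted_wrt (P x) xs \<and> triplewise P xs"

lemma triplewiseD:
  assumes "triplewise P xs" "i < j" "j < k" "k < length xs"
  shows "P (xs ! i) (xs ! j) (xs ! k)"
  using assms
proof (induction xs arbitrary: i j k)
  case (Cons x xs)
  obtain j' k' where jk: "j = Suc j'" "k = Suc k'" using Cons.prems by (cases j; cases k) auto
  show ?case
  proof (cases i)
    case 0
    thus ?thesis using Cons.prems jk sorted_wrt_nth_less[of "P x" xs j' k'] by simp
  next
    case (Suc i')
    thus ?thesis using Cons.prems jk Cons.IH[of i' j' k'] by simp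
  qed
qed simp

text \<open>The triples \<open>(5, 8, 11)\<close> and \<open>(6, 7, 12)\<close> are the only ones at which the two
  configurations have different orientations.\<close>
fun signs_match :: "nat \<times> (int \<times> int \<times> int) \<times> (int \<times> int \<times> int) \<Rightarrow> nat \<times> (int \<times> int \<times> int) \<times> (int \<times> int \<times> int) \<Rightarrow>
    nat \<times> (int \<times> int \<times> int) \<times> (int \<times> int \<times> int) \<Rightarrow> bool" where
  "signs_match (i,a,a') (j,b,b') (k,c,c') \<longleftrightarrow>
     (let x = det_of a b c; y = det_of a' b' c' in
      if (i, j, k) \<in> {(5, 8, 11), (6, 7, 12)} then x \<noteq> 0 \<and> y \<noteq> 0 else if 0 < x then 0 < y else x < 0 \<and> y < 0)"

lemma signs_match: "triplewise signs_match (zip [0..<21] (zip plus_list minus_list))"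
  by (simp add: plus_list_def minus_list_def upt_conv_Cons)

lemma det3_swap: "det3 u j i k = - det3 u i j k" "det3 u i k j = - det3 u i j k"
  by (simp_all add: det3_def algebra_simps)

lemma generic_if_sorted:
  assumes "\<And>i j k. i < j \<Longrightarrow> j < k \<Longrightarrow> k < n \<Longrightarrow> det3 u i j k \<noteq> 0"
  shows "generic u n"
  unfolding generic_def
proof (intro allI impI)
  fix i j k assume lt: "i < n" "j < n" "k < n" "distinct [i, j, k]"
  consider "i < j" "j < k" | "i < k" "k < j" | "j < i" "i < k" | "j < k" "k < i" | "k < i" "i < j" | "k < j" "j < i"
    using lt(4) by fastforce
  then show "det3 u i j k \<noteq> 0"
    using assms[of i j k] assms[of i k j] assms[of j i k] assms[of j k i] assms[of k i j] assms[of k j i] lt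
      det3_swap(1)[of u] det3_swap(2)[of u]
    by cases (metis neg_equal_0_iff_equal)+
qed

lemma length_vectors [simp]: "length plus_list = 21" "length minus_list = 21"
  by (simp_all add: plus_list_def minus_list_def)

lemma vectors_signs:
  assumes "i < j" "j < k" "k < 21"
  shows "det3 (vec_of plus_list) i j k \<noteq> 0" "det3 (vec_of minus_list) i j k \<noteq> 0"
    "(i, j, k) \<notin> {(5, 8, 11), (6, 7, 12)} \<Longrightarrow> sgn (det3 (vec_of plus_list) i j k) = sgn (det3 (vec_of minus_list) i j k)"
  using triplewiseD[OF signs_match assms(1,2)] assms
  by (simp_all add: det3_vec_of Let_def del: insert_iff split: if_splits)

lemma generic_vectors: "generic (vec_of plus_list) 21" "generic (vec_of minus_list) 21"
  using vectors_signs by (blast intro: generic_if_sorted)+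

fun circuit_of where
  "circuit_of a b c d \<longleftrightarrow> (let s = sgn (det_of a b c) in s \<noteq> 0 \<and> sgn (det_of a b d) = - s \<and>
     sgn (det_of a c d) = s \<and> sgn (det_of b c d) = - s)"

lemma circuit_signs_vec_of: "circuit_signs (vec_of L) i j k l \<longleftrightarrow> circuit_of (L ! i) (L ! j) (L ! k) (L ! l)"
proof -
  have *: "sgn (of_int x :: real) = of_int (sgn x)" for x by (simp add: sgn_if)
  have "of_int a = (- of_int b :: real) \<longleftrightarrow> a = - b" for a b
    by (metis of_int_eq_iff of_int_minus)
  thus ?thesis by (simp add: circuit_signs_def det3_vec_of * Let_def)
qed

lemma exceptional_triples_in_no_circuit:
  "\<forall>d\<in>set plus_list. \<not> circuit_of (plus_list ! 5) (plus_list ! 8) (plus_list ! 11) d"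
  "\<forall>d\<in>set plus_list. \<not> circuit_of (plus_list ! 6) (plus_list ! 7) (plus_list ! 12) d"
  "\<forall>d\<in>set minus_list. \<not> circuit_of (minus_list ! 5) (minus_list ! 8) (minus_list ! 11) d"
  "\<forall>d\<in>set minus_list. \<not> circuit_of (minus_list ! 6) (minus_list ! 7) (minus_list ! 12) d"
  by (simp_all add: plus_list_def minus_list_def)

declare circuit_of.simps [simp del]

text \<open>The positive circuits are read off from the orientations of triples. These agree except at two triples,
  and neither of those is part of a positive circuit of either configuration.\<close>
lemma same_circuits:
  assumes "J \<subseteq> {..<21}" "card J = 4"
  shows "pos_dep (vec_of plus_list) J \<longleftrightarrow> pos_dep (vec_of minus_list) J"
proof -
  have no: "\<not> pos_dep (vec_of L) {a, b, c, m}"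
    if "generic (vec_of L) 21" "\<forall>d\<in>set L. \<not> circuit_of (L ! a) (L ! b) (L ! c) d" "length L = 21"
      "distinct [a, b, c, m]" "a < 21" "b < 21" "c < 21" "m < 21" for L a b c m
    using circuit_signs_if_pos_dep[of a b c m "vec_of L"] that by (auto simp: circuit_signs_vec_of generic_def)
  have gone: ?thesis if T: "T \<subseteq> J" "T = {5, 8, 11} \<or> T = {6, 7, 12}" for T
  proof -
    have "finite J" "card T = 3" using assms T by (auto simp: card_ge_0_finite)
    hence "card (J - T) = 1" using T(1) assms(2) by (simp add: card_Diff_subset finite_subset)
    then obtain m where "J - T = {m}" by (auto simp: card_1_singleton_iff)
    hence m: "J = T \<union> {m}" "m \<notin> T" "m < 21" using T(1) assms(1) by auto
    note ex = exceptional_triples_in_no_circuit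
    from T(2) show ?thesis
    proof
      assume "T = {5, 8, 11}"
      hence "J = {5, 8, 11, m}" "distinct [5, 8, 11, m]" using m by auto
      thus ?thesis using no[OF generic_vectors(1) ex(1)] no[OF generic_vectors(2) ex(3)] m(3) by simp
    next
      assume "T = {6, 7, 12}"
      hence "J = {6, 7, 12, m}" "distinct [6, 7, 12, m]" using m by auto
      thus ?thesis using no[OF generic_vectors(1) ex(2)] no[OF generic_vectors(2) ex(4)] m(3) by simp
    qed
  qed
  obtain i j k l where o: "i < j" "j < k" "k < l" "l < 21" "J = {i, j, k, l}"
    using sorted4[OF assms(2,1)] by metis
  show ?thesis
  proof (cases "{5, 8, 11} \<subseteq> J \<or> {6, 7, 12} \<subseteq> J")
    case True thus ?thesis using gone by blast
  next
    case False
    have D: "sgn (det3 (vec_of plus_list) a b c) = sgn (det3 (vec_of minus_list) a b c)"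
      if "a < b" "b < c" "c < 21" "a \<in> J" "b \<in> J" "c \<in> J" for a b c
      using vectors_signs(3)[of a b c] that False by auto
    have "circuit_signs (vec_of plus_list) i j k l \<longleftrightarrow> circuit_signs (vec_of minus_list) i j k l"
      using D[of i j k] D[of i j l] D[of i k l] D[of j k l] o by (simp add: circuit_signs_def Let_def)
    moreover have "pos_dep (vec_of L) J \<longleftrightarrow> circuit_signs (vec_of L) i j k l" if "generic (vec_of L) 21" for L
      using circuit_signs_if_pos_dep[of i j k l "vec_of L"] pos_dep_if_circuit_signs[of i j k l "vec_of L"] that o
      unfolding generic_def by auto
    ultimately show ?thesis using generic_vectors by blast
  qed
qed

definition agree :: "(nat \<Rightarrow> nat \<Rightarrow> real) \<Rightarrow> (nat \<Rightarrow> nat \<Rightarrow> real) \<Rightarrow> nat \<times> nat \<times> nat \<Rightarrow> bool" where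
  "agree v u = (\<lambda>(i, j, k). det3 u i j k \<noteq> 0 \<and> sgn (det3 v i j k) = sgn (det3 u i j k))"

fun faces_of :: "nat \<times> nat \<times> nat \<times> nat \<Rightarrow> (nat \<times> nat \<times> nat) list" where
  "faces_of (i, j, k, l) = [(i, j, k), (i, j, l), (i, k, l), (j, k, l)]"

text \<open>Starting from triples of known orientation, a positive circuit that contains one of them fixes the
  orientations of its other triples. A circuit that contains none stops the process.\<close>
fun propagate where
  "propagate K [] = K"
| "propagate K (J # Js) = (if list_ex (\<lambda>t. t \<in> set K) (faces_of J) then propagate (faces_of J @ K) Js else K)"

lemma circuit_nonzero:
  assumes "distinct [i, j, k, l]" "pos_dep u {i, j, k, l}"
    "det3 u i j k \<noteq> 0 \<or> det3 u i j l \<noteq> 0 \<or> det3 u i k l \<noteq> 0 \<or> det3 u j k l \<noteq> 0"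
  shows "circuit_signs u i j k l"
proof -
  obtain c where c: "c i > 0" "c j > 0" "c k > 0" "c l > 0"
    and r: "\<forall>b<3. c i * u i b + c j * u j b + c k * u k b + c l * u l b = 0"
    using assms unfolding pos_dep_def sum4[OF assms(1)] by auto
  have "det3 u i j k \<noteq> 0" using assms(3) cramer_relation[OF r] c by auto
  thus ?thesis using circuit_signs_if_pos_dep assms by blast
qed

text \<open>The orientations of the four triples of a positive circuit alternate, so they are determined up to a
  common sign.\<close>
lemma circuit_agree:
  assumes "distinct [i, j, k, l]" "pos_dep v {i, j, k, l}" "pos_dep u {i, j, k, l}"
    and "t \<in> set (faces_of (i, j, k, l))" "agree v u t" and t': "t' \<in> set (faces_of (i, j, k, l))"
  shows "agree v u t'"
proof -
  have "det3 w i j k \<noteq> 0 \<or> det3 w i j l \<noteq> 0 \<or> det3 w i k l \<noteq> 0 \<or> det3 w j k l \<noteq> 0" if "w = v \<or> w = u" for w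
    using assms(4,5) that by (auto simp: agree_def) (metis sgn_eq_0_iff)+
  hence "circuit_signs v i j k l" "circuit_signs u i j k l" using circuit_nonzero assms(1-3) by blast+
  thus ?thesis using assms(4-6) by (auto simp: agree_def circuit_signs_def Let_def sgn_eq_0_iff)
qed

lemma agree_propagate:
  assumes "\<And>t. t \<in> set K \<Longrightarrow> agree v u t"
    and "\<And>i j k l. (i, j, k, l) \<in> set Js \<Longrightarrow> distinct [i, j, k, l] \<and> pos_dep v {i, j, k, l} \<and> pos_dep u {i, j, k, l}"
    and "t \<in> set (propagate K Js)"
  shows "agree v u t"
  using assms
proof (induction Js arbitrary: K)
  case (Cons J Js)
  obtain i j k l where J: "J = (i, j, k, l)" by (cases J)
  show ?case
  proof (cases "list_ex (\<lambda>t. t \<in> set K) (faces_of J)")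
    case True
    then obtain t0 where t0: "t0 \<in> set K" "t0 \<in> set (faces_of (i, j, k, l))" by (auto simp: list_ex_iff J)
    have c: "distinct [i, j, k, l]" "pos_dep v {i, j, k, l}" "pos_dep u {i, j, k, l}"
      using Cons.prems(2)[of i j k l] by (simp_all add: J)
    show ?thesis
    proof (rule Cons.IH)
      show "t \<in> set (propagate (faces_of J @ K) Js)" using Cons.prems(3) True by simp
      show "agree v u t'" if "t' \<in> set (faces_of J @ K)" for t'
        using that circuit_agree[OF c t0(2) Cons.prems(1)[OF t0(1)]] Cons.prems(1) unfolding J set_append by blast
    qed (use Cons.prems(2) in auto)
  next
    case False
    have "propagate K (J # Js) = K" using False by (simp only: propagate.simps if_False)
    thus ?thesis using Cons.prems by simp
  qed
qed simp

lemma circuit_chain_circuits: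
  "list_all (\<lambda>(i, j, k, l). i < j \<and> j < k \<and> k < l \<and> l < 21 \<and>
     circuit_of (plus_list ! i) (plus_list ! j) (plus_list ! k) (plus_list ! l)) circuit_chain"
  by code_simp

lemma circuit_chain_reaches_brackets:
  "list_all (\<lambda>(i, j, k, s). (i, j, k) \<in> set (propagate [(0, 1, 2)] circuit_chain)) brackets"
  by code_simp

lemma brackets_plus:
  "list_all (\<lambda>(i, j, k, s). 0 < s * det_of (plus_list ! i) (plus_list ! j) (plus_list ! k)) brackets"
  by code_simp

lemma circuit_chain_pos_dep:
  assumes "(i, j, k, l) \<in> set circuit_chain"
  shows "distinct [i, j, k, l]" "{i, j, k, l} \<subseteq> {..<21}" "pos_dep (vec_of plus_list) {i, j, k, l}"
proof -
  have "i < j \<and> j < k \<and> k < l \<and> l < 21 \<and> circuit_of (plus_list ! i) (plus_list ! j) (plus_list ! k) (plus_list ! l)"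
    using circuit_chain_circuits assms unfolding list_all_iff by fast
  thus 1: "distinct [i, j, k, l]" "{i, j, k, l} \<subseteq> {..<21}" 
    "pos_dep (vec_of plus_list) {i, j, k, l}"
    by (auto intro!: pos_dep_if_circuit_signs simp: circuit_signs_vec_of simp del: circuit_of.simps)
qed

text \<open>The chain transports the orientation of the frame to all listed triples, so their signs can be read off
  from the integer vectors.\<close>
lemma forced_brackets:
  assumes basis: "\<And>b. v 0 b = (if b = 0 then 1 else 0)" "\<And>b. v 1 b = (if b = 1 then 1 else 0)"
     "\<And>b. v 2 b = (if b = 2 then 1 else 0)"
    and circ: "\<And>i j k l. (i, j, k, l) \<in> set circuit_chain \<Longrightarrow> pos_dep v {i, j, k, l}"
  shows "list_all (\<lambda>(i, j, k, s). 0 < of_int s * det3 v i j k) brackets"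
  unfolding list_all_iff
proof clarify
  fix i j k s assume ijks: "(i, j, k, s) \<in> set brackets"
  have e012: "agree v (vec_of plus_list) (0, 1, 2)"
    using basis[unfolded One_nat_def] by (simp add: agree_def det3_def vec_of_def plus_list_def)
  have "(i, j, k) \<in> set (propagate [(0, 1, 2)] circuit_chain)"
    using circuit_chain_reaches_brackets ijks unfolding list_all_iff by fast
  hence "agree v (vec_of plus_list) (i, j, k)"
    by (rule agree_propagate[rotated 2]) (use e012 circuit_chain_pos_dep circ in auto)
  hence "sgn (det3 v i j k) = sgn (of_int (det_of (plus_list ! i) (plus_list ! j) (plus_list ! k)))"
    by (simp add: agree_def det3_vec_of)
  moreover have "0 < s * det_of (plus_list ! i) (plus_list ! j) (plus_list ! k)"
    using brackets_plus ijks unfolding list_all_iff by fast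
  ultimately show "0 < of_int s * det3 v i j k"
    by (auto simp: zero_less_mult_iff sgn_if split: if_splits)
qed

text \<open>The difference of the two sides in \<open>secant_hyperbola_caps\<close> for
  \<open>p1, p2, c2, c3 = 5, 6, 7, 8\<close>, cleared of denominators. It is linear in each of the four
  vectors.\<close>
definition secant_gap :: "(nat \<Rightarrow> nat \<Rightarrow> real) \<Rightarrow> real" where
  "secant_gap v = - v 5 0 * v 6 2 * (v 7 1 * v 8 2 - v 8 1 * v 7 2) - v 6 1 * v 5 2 * (v 7 0 * v 8 2 - v 8 0 * v 7 2)"

text \<open>With this sign of the first coordinate the points \<open>5\<close> and \<open>6\<close> fall into the
  positive quadrant.\<close>
definition affine_pt :: "(nat \<Rightarrow> nat \<Rightarrow> real) \<Rightarrow> nat \<Rightarrow> real \<times> real" where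
  "affine_pt v k = (- v k 0 / v k 2, v k 1 / v k 2)"

lemma orient_affine:
  assumes "v i 2 \<noteq> 0" "v j 2 \<noteq> 0" "v k 2 \<noteq> 0"
  shows "orient (affine_pt v i) (affine_pt v j) (affine_pt v k) = - det3 v i j k / (v i 2 * v j 2 * v k 2)"
  using assms by (simp add: orient_def affine_pt_def det3_def field_simps)

text \<open>The prescribed orientations translate into the hypotheses of the planar argument. The products of
  intercepts of the outer secants \<open>8, 7\<close> and \<open>12, 11\<close> are compared via the intermediate
  secant \<open>10, 9\<close>.\<close>
lemma secant_gap_nonzero:
  assumes basis: "\<And>b. v 0 b = (if b = 0 then 1 else 0)" "\<And>b. v 1 b = (if b = 1 then 1 else 0)"
     "\<And>b. v 2 b = (if b = 2 then 1 else 0)"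
    and signs: "list_all (\<lambda>(i, j, k, s). 0 < of_int s * det3 v i j k) brackets"
  shows "secant_gap v \<noteq> 0"
proof -
  define p where "p = affine_pt v"
  define Z where "Z k = v k 2" for k
  note S = signs[unfolded brackets_def, simplified]
  note basis' = basis[unfolded One_nat_def]
  have co: "det3 v 0 1 k = Z k" "det3 v 1 2 k = v k 0" "det3 v 0 2 k = - v k 1" for k
    by (simp_all add: det3_def basis' Z_def)
  have V: "v 5 0 > 0" "v 6 0 > 0" "v 7 0 > 0" "v 9 0 < 0" "v 11 0 > 0" "v 5 1 < 0" "v 11 1 < 0" "v 9 1 > 0"
    "v 8 1 > 0" "v 10 1 < 0" "v 12 1 > 0" using S co[unfolded One_nat_def] by simp_all
  have Z: "Z 3 > 0" "Z 4 > 0" "Z 5 < 0" "Z 6 < 0" "Z 7 < 0" "Z 8 < 0" "Z 9 > 0" "Z 10 > 0" "Z 11 < 0" "Z 12 < 0"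
    "Z 13 < 0" "Z 14 > 0" using S co[unfolded One_nat_def] by simp_all
  note V' = V[unfolded One_nat_def]
  have ne: "Z k \<noteq> 0" if "k \<in> {3, 4, 5, 6, 7, 8, 9, 10, 11, 12, 13, 14}" for k
    using that Z by auto
  have or: "0 < orient (p i) (p j) (p k) \<longleftrightarrow> det3 v i j k * (Z i * Z j * Z k) < 0"
      "orient (p i) (p j) (p k) < 0 \<longleftrightarrow> 0 < det3 v i j k * (Z i * Z j * Z k)"
    if "{i, j, k} \<subseteq> {3, 4, 5, 6, 7, 8, 9, 10, 11, 12, 13, 14}" for i j k
    using orient_affine[of v i j k] ne that
    by (simp_all add: p_def[symmetric] Z_def[symmetric] zero_less_divide_iff divide_less_0_iff mult_less_0_iff zero_less_mult_iff)
  have x: "fst (p i) - fst (p j) = det3 v 1 i j / (Z i * Z j)"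
    and y: "snd (p i) - snd (p j) = det3 v 0 i j / (Z i * Z j)" if "{i, j} \<subseteq> {3, 4, 5, 6, 7, 8, 9, 10, 11, 12, 13, 14}" for i j
    using ne[of i] ne[of j] that by (simp_all add: p_def affine_pt_def det3_def basis' Z_def field_simps)
  have xl: "fst (p i) < fst (p j) \<longleftrightarrow> det3 v 1 i j / (Z i * Z j) < 0"
    and yl: "snd (p i) < snd (p j) \<longleftrightarrow> det3 v 0 i j / (Z i * Z j) < 0" if "{i, j} \<subseteq> {3, 4, 5, 6, 7, 8, 9, 10, 11, 12, 13, 14}" for i j
    using x[OF that] y[OF that] by auto
  \<comment> \<open>Rewrites determinants with concrete labels to increasing order of the labels.\<close>
  have sort: "j < i \<Longrightarrow> det3 v i j k = - det3 v j i k" "k < j \<Longrightarrow> det3 v i j k = - det3 v i k j" for i j k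
    by (simp_all add: det3_def algebra_simps)
  have x0: "0 < fst (p k) \<longleftrightarrow> v k 0 / Z k < 0" "snd (p k) < 0 \<longleftrightarrow> v k 1 / Z k < 0" "0 < snd (p k) \<longleftrightarrow> 0 < v k 1 / Z k" for k
    by (simp_all add: p_def affine_pt_def Z_def)
  note sg = or xl yl x0 sort zero_less_divide_iff divide_less_0_iff zero_less_mult_iff mult_less_0_iff
  note M = icpt_product_mono[of "p 8" "p 10" "p 7" "p 9" "p 13"]
    and M' = icpt_product_mono[of "p 10" "p 12" "p 9" "p 11" "p 14"]
  have 1: "yicpt (p 10) (p 9) ^ 2 / steep (p 10) (p 9) \<le> yicpt (p 8) (p 7) ^ 2 / steep (p 8) (p 7)"
      "0 < steep (p 8) (p 7)" "0 < yicpt (p 8) (p 7)"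
    by ((rule M(5) M(1) M(4); simp add: sg S Z V')+)
  have 2: "yicpt (p 12) (p 11) ^ 2 / steep (p 12) (p 11) \<le> yicpt (p 10) (p 9) ^ 2 / steep (p 10) (p 9)"
      "0 < steep (p 12) (p 11)" "0 < yicpt (p 12) (p 11)"
    by ((rule M'(5) M'(2) M'(3); simp add: sg S Z V')+)
  have 3: "fst (p 5) * (snd (p 7) - snd (p 8)) \<noteq> snd (p 6) * (fst (p 8) - fst (p 7))"
  proof (rule secant_hyperbola_caps[where n = "p 4" and h = "p 3" and ?d3.0 = "p 12" and ?d2.0 = "p 11"])
    show "yicpt (p 12) (p 11) ^ 2 / steep (p 12) (p 11) \<le> yicpt (p 8) (p 7) ^ 2 / steep (p 8) (p 7)"
      using 1 2 by linarith
    have "fst (p 5) * snd (p 6) - snd (p 5) * fst (p 6) = - det3 v 2 5 6 / (Z 5 * Z 6)"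
      using ne[of 5] ne[of 6] by (simp add: p_def affine_pt_def det3_def basis' Z_def field_simps)
    also have "\<dots> < 0" by (simp add: sg S Z)
    finally show "fst (p 5) * snd (p 6) < snd (p 5) * fst (p 6)" by simp
      show "fst (p 11) < fst (p 12)"
      by (rule less_trans[of _ "fst (p 10)"]) (simp_all add: sg S Z)
  qed (simp_all add: sg S Z V' 1 2)
  have c: "v k 0 = - fst (p k) * Z k" "v k 1 = snd (p k) * Z k" if "k \<in> {5, 6, 7, 8}" for k
    using that ne[of k] by (auto simp: p_def affine_pt_def Z_def)
  have "secant_gap v = Z 5 * Z 6 * Z 7 * Z 8 * (fst (p 5) * (snd (p 7) - snd (p 8)) - snd (p 6) * (fst (p 8) - fst (p 7)))"
    unfolding secant_gap_def Z_def[symmetric] by (simp only: c insert_iff simp_thms) (simp add: algebra_simps)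
  with 3 show ?thesis using ne by simp
qed

section \<open>Weights for the two configurations\<close>

text \<open>The vector carried by each of the first \<open>29\<close> labels. Repetitions do not affect positive
  dependence and fill up the number of labels. The labels \<open>26, 27, 28\<close> carry the standard basis, as
  \<^const>\<open>star_vec\<close> demands, and the labels \<open>0, \<dots>, 3\<close> carry further copies of it,
  whose weights and lengths are free to satisfy the constraints of the construction.\<close>
definition core_of :: "nat list" where
  "core_of = [0, 0, 1, 2, 3, 4, 5, 6, 7, 8, 9, 10, 11, 12, 13, 14, 15, 16, 17, 18, 19, 20, 8, 14, 15, 15, 0, 1, 2]"

text \<open>A label that carries a given vector.\<close>
definition rep :: "nat \<Rightarrow> nat" where "rep k = (if k < 3 then 26 + k else k + 1)"

text \<open>The factors make the weighted sum of the vectors negative enough in each coordinate. Together with the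
  denominator \<open>90000\<close> below they satisfy both inequalities of \<open>feasible\<close> for both
  configurations: the denominator is small enough for \<open>tail1 < - 1\<close> and large enough for the squares in
  \<open>tail2\<close> not to outweigh the linear terms.\<close>
definition mult_of :: "nat \<Rightarrow> real" where
  "mult_of k = (if k = 8 then 109 else if k = 14 then 25 else if k = 15 then 19 else 1)"

definition tail_wt :: "(int \<times> int \<times> int) list \<Rightarrow> nat \<Rightarrow> nat \<Rightarrow> real" where
  "tail_wt L i b = mult_of (core_of ! i) * vec_of L (core_of ! i) b / 90000"

definition tail1 :: "(int \<times> int \<times> int) list \<Rightarrow> nat \<Rightarrow> real" where
  "tail1 L b = (\<Sum>i\<in>{4..<26}. tail_wt L i b)"
definition tail2 :: "(int \<times> int \<times> int) list \<Rightarrow> nat \<Rightarrow> real" where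
  "tail2 L b = (\<Sum>i\<in>{4..<26}. (tail_wt L i b)\<^sup>2)"

text \<open>Chosen so that the column sums of the weights are \<open>- 1\<close>; the first basis vector has two
  copies among the labels \<open>0, \<dots>, 3\<close>.\<close>
definition head_wt :: "(int \<times> int \<times> int) list \<Rightarrow> nat \<Rightarrow> real" where
  "head_wt L b = (- tail1 L b - 1) / (if b = 0 then 2 else 1)"

definition wt :: "(int \<times> int \<times> int) list \<Rightarrow> nat \<Rightarrow> nat \<Rightarrow> real" where
  "wt L i b = (if 4 \<le> i then tail_wt L i b else if core_of ! i = b then head_wt L b else 0)"

text \<open>The value at \<open>i = 1, 2, 3\<close> solves the quadratic constraint of column \<open>i - 1\<close>.
  Label \<open>0\<close> is the origin.\<close>
definition sqlen :: "(int \<times> int \<times> int) list \<Rightarrow> nat \<Rightarrow> real" where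
  "sqlen L i = (if 4 \<le> i then 1 else if i = 0 then 0
     else - (tail1 L (i - 1) + tail2 L (i - 1)) / (head_wt L (i - 1) + (head_wt L (i - 1))\<^sup>2))"

text \<open>The inequalities say that the weights on the basis vectors and the squared lengths come out
  positive.\<close>
definition feasible :: "(int \<times> int \<times> int) list \<Rightarrow> bool" where
  "feasible L \<longleftrightarrow> take 3 L = [(1, 0, 0), (0, 1, 0), (0, 0, 1)] \<and>
     (\<forall>b<3. tail1 L b < - 1 \<and> tail1 L b + tail2 L b < 0)"

lemma feasible_vectors: "feasible plus_list" "feasible minus_list"
proof -
  have S: "(\<Sum>i\<in>{4..<26}. f i) = sum_list (map f [4..<26])" for f :: "nat \<Rightarrow> real"
    by (simp only: interv_sum_list_conv_sum_set_nat set_upt)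
  show "feasible plus_list" "feasible minus_list"
    unfolding feasible_def all_less_3 tail1_def tail2_def S
    by (simp_all add: upt_conv_Cons tail_wt_def core_of_def mult_of_def vec_of_def plus_list_def minus_list_def power_divide)
qed

lemma sum_26: "(\<Sum>i<(26::nat). f i :: real) = f 0 + f 1 + f 2 + f 3 + (\<Sum>i\<in>{4..<26}. f i)"
proof -
  have "{..<26::nat} = {0, 1, 2, 3} \<union> {4..<26}" by auto
  thus ?thesis by (simp add: sum.union_disjoint)
qed

lemma core_of_head: "core_of ! 0 = 0" "core_of ! 1 = 0" "core_of ! 2 = 1" "core_of ! 3 = 2"
  by (simp_all add: core_of_def)

lemma b_cases: "(b::nat) < 3 \<longleftrightarrow> b = 0 \<or> b = 1 \<or> b = 2" by auto

definition config_of :: "(int \<times> int \<times> int) list \<Rightarrow> (25, 30) config" where "config_of L = star_config (wt L) (sqlen L)"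

definition copy_scale :: "(int \<times> int \<times> int) list \<Rightarrow> nat \<Rightarrow> real" where
  "copy_scale L k = (if k < 4 then head_wt L (core_of ! k) else if k < 26 then mult_of (core_of ! k) / 90000 else 1)"

context
  fixes L assumes L: "feasible L"
begin

lemma head_wt_pos: "b < 3 \<Longrightarrow> 0 < head_wt L b"
  using L by (simp add: feasible_def head_wt_def)

lemma wt_sum: "b < 3 \<Longrightarrow> (\<Sum>i<26. wt L i b) = - 1"
proof -
  have "(\<Sum>i\<in>{4..<26}. wt L i b) = tail1 L b" unfolding tail1_def by (intro sum.cong) (auto simp: wt_def)
  moreover assume "b < 3"
  ultimately show ?thesis unfolding sum_26 b_cases
    by (elim disjE) (simp_all add: wt_def core_of_head[unfolded One_nat_def] head_wt_def)
qed

lemma sqlen_pos: "0 < i \<Longrightarrow> i < 26 \<Longrightarrow> 0 < sqlen L i"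
proof (cases "4 \<le> i")
  case False
  assume "0 < i"
  hence b: "i - 1 < 3" using False by simp
  hence "0 < head_wt L (i - 1) + (head_wt L (i - 1))\<^sup>2" using head_wt_pos[OF b] by (simp add: add_pos_pos)
  moreover have "tail1 L (i - 1) + tail2 L (i - 1) < 0" using L b by (simp add: feasible_def)
  ultimately show ?thesis using False \<open>0 < i\<close> by (simp add: sqlen_def zero_less_divide_iff divide_less_0_iff)
qed (simp add: sqlen_def)

lemma wt_sqlen_sum: "b < 3 \<Longrightarrow> (\<Sum>i<26. sqlen L i * (wt L i b + (wt L i b)\<^sup>2)) = 0"
proof -
  assume b: "b < 3"
  have "(\<Sum>i\<in>{4..<26}. sqlen L i * (wt L i b + (wt L i b)\<^sup>2)) = tail1 L b + tail2 L b"
    unfolding tail1_def tail2_def sum.distrib[symmetric] by (intro sum.cong) (auto simp: wt_def sqlen_def)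
  moreover have "0 < head_wt L b + (head_wt L b)\<^sup>2" using head_wt_pos[OF b] by (simp add: add_pos_pos)
  hence "sqlen L (b + 1) * (head_wt L b + (head_wt L b)\<^sup>2) = - (tail1 L b + tail2 L b)"
    using b by (simp add: sqlen_def)
  ultimately show ?thesis using b unfolding sum_26 b_cases
    by (elim disjE) (simp_all add: wt_def core_of_head[unfolded numeral_2_eq_2 numeral_3_eq_3 One_nat_def] sqlen_def[of L 0]
          numeral_3_eq_3 numeral_2_eq_2)
qed

lemma copy_scale_pos: "k < 29 \<Longrightarrow> 0 < copy_scale L k"
proof -
  have "core_of ! k < 3" if "k < 4"
  proof -
    have "k = 0 \<or> k = 1 \<or> k = 2 \<or> k = 3" using that by auto
    thus ?thesis using core_of_head by auto
  qed
  thus "0 < copy_scale L k" using head_wt_pos by (simp add: copy_scale_def mult_of_def)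
qed

lemma vec_basis: "k < 3 \<Longrightarrow> b < 3 \<Longrightarrow> vec_of L k b = (if b = k then 1 else 0)"
proof -
  have t: "L ! k = take 3 L ! k" if "k < 3" using that by simp
  assume "k < 3" "b < 3"
  thus ?thesis unfolding vec_of_def t[OF \<open>k < 3\<close>] using L unfolding b_cases by (auto simp: feasible_def numeral_2_eq_2)
qed

lemma star_vec_eq:
  assumes "k < 29" "b < 3"
  shows "star_vec (wt L) k b = copy_scale L k * vec_of L (core_of ! k) b"
proof -
  consider "k < 4" | "4 \<le> k" "k < 26" | "26 \<le> k" by linarith
  thus ?thesis
  proof cases
    case 1
    hence "k = 0 \<or> k = 1 \<or> k = 2 \<or> k = 3" by auto
    hence "core_of ! k < 3" using core_of_head by auto
    thus ?thesis using 1 vec_basis[of "core_of ! k" b] assms by (simp add: star_vec_def wt_def copy_scale_def)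
  next
    case 3
    hence "k = 26 \<or> k = 27 \<or> k = 28" using assms by auto
    hence "core_of ! k = k - 26" "k - 26 < 3" by (auto simp: core_of_def)
    thus ?thesis using 3 vec_basis[of "k - 26" b] assms by (simp add: star_vec_def copy_scale_def)
  qed (simp add: star_vec_def wt_def copy_scale_def tail_wt_def)
qed

lemma lower_face_config_of:
  "lower_face (config_of L) S \<longleftrightarrow>
     {k. k < 29 \<and> pt_ix k \<notin> S} \<noteq> {} \<and> pos_dep (vec_of L) ((!) core_of ` {k. k < 29 \<and> pt_ix k \<notin> S})"
proof -
  have "pos_dep (star_vec (wt L)) {k. k < 29 \<and> pt_ix k \<notin> S} \<longleftrightarrow>
      pos_dep (vec_of L) ((!) core_of ` {k. k < 29 \<and> pt_ix k \<notin> S})"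
    by (rule pos_dep_scaled_copies[of _ "copy_scale L"]) (auto simp: star_vec_eq copy_scale_pos)
  thus ?thesis unfolding config_of_def
    by (subst lower_face_star_iff) (auto simp: sqlen_pos wt_sum wt_sqlen_sum sqlen_def[of L 0] Let_def)
qed

end

section \<open>The common Delaunay triangulation\<close>

lemma pos_dep_superset:
  assumes gen: "generic u n" and n: "3 \<le> n" and Z: "pos_dep u Z" "Z \<noteq> {}" "Z \<subseteq> Z'" "Z' \<subseteq> {..<n}"
  shows "pos_dep u Z'"
proof -
  have "pos_dep u (Z \<union> Y)" if "finite Y" "Y \<subseteq> {..<n}" for Y
    using that
  proof (induction Y)
    case (insert m Y)
    have "pos_dep u (insert m (Z \<union> Y))"
      by (rule pos_dep_insert[OF gen n]) (use insert Z in auto)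
    thus ?case by simp
  qed (use Z in simp)
  moreover have "finite Z'" using Z(4) finite_subset by blast
  ultimately have "pos_dep u (Z \<union> Z')" using Z(4) by blast
  thus ?thesis using Z(3) by (simp add: Un_absorb1)
qed

lemma core_of_lt: "k < 29 \<Longrightarrow> core_of ! k < 21"
proof -
  have "length core_of = 29" "list_all (\<lambda>c. c < 21) core_of" by (simp_all add: core_of_def)
  thus "k < 29 \<Longrightarrow> core_of ! k < 21" by (simp add: list_all_length)
qed

lemma rep_lt: "k < 21 \<Longrightarrow> rep k < 29" by (simp add: rep_def)

lemma inj_on_rep: "inj_on rep {..<21}" by (auto simp: inj_on_def rep_def split: if_splits)

lemma core_of_rep: "k < 21 \<Longrightarrow> core_of ! rep k = k"
proof -
  have "list_all (\<lambda>k. core_of ! rep k = k) [0..<21]" by (simp add: upt_conv_Cons rep_def core_of_def)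
  thus "k < 21 \<Longrightarrow> core_of ! rep k = k" by (simp add: list_all_iff)
qed

lemma base_circuit: "pos_dep (vec_of plus_list) {0, 1, 2, 15}"
  using circuit_chain_pos_dep(3)[of 0 1 2 15] by (simp add: circuit_chain_def)

lemma pos_dep_plus_iff_minus:
  "Z \<subseteq> {..<21} \<Longrightarrow> pos_dep (vec_of plus_list) Z \<longleftrightarrow> pos_dep (vec_of minus_list) Z"
  using pos_dep_cong_circuits[OF generic_vectors(1), of "vec_of minus_list" Z]
    pos_dep_cong_circuits[OF generic_vectors(2), of "vec_of plus_list" Z] same_circuits by auto

definition plus_config :: "(25, 30) config" where "plus_config = config_of plus_list"
definition minus_config :: "(25, 30) config" where "minus_config = config_of minus_list"

text \<open>The common Delaunay poset: all sets of labels whose complement, apart from the apex \<open>29\<close>, is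
  not empty and carries positively dependent vectors.\<close>
definition star_faces :: "30 set set" where
  "star_faces = {S. {k. k < 29 \<and> pt_ix k \<notin> S} \<noteq> {} \<and>
     pos_dep (vec_of plus_list) ((!) core_of ` {k. k < 29 \<and> pt_ix k \<notin> S})}"

lemma lower_face_configs:
  "lower_face plus_config S \<longleftrightarrow> S \<in> star_faces" "lower_face minus_config S \<longleftrightarrow> S \<in> star_faces"
proof -
  have "(!) core_of ` {k. k < 29 \<and> pt_ix k \<notin> S} \<subseteq> {..<21}" using core_of_lt by auto
  thus "lower_face plus_config S \<longleftrightarrow> S \<in> star_faces" "lower_face minus_config S \<longleftrightarrow> S \<in> star_faces"
    unfolding plus_config_def minus_config_def star_faces_def
    by (simp_all only: lower_face_config_of[OF feasible_vectors(1)] lower_face_config_of[OF feasible_vectors(2)]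
        pos_dep_plus_iff_minus mem_Collect_eq)
qed

lemma star_faces_if_circuit:
  assumes "pos_dep (vec_of plus_list) J" "J \<noteq> {}" "J \<subseteq> (!) core_of ` {k. k < 29 \<and> pt_ix k \<notin> S}"
  shows "S \<in> star_faces"
proof -
  have "(!) core_of ` {k. k < 29 \<and> pt_ix k \<notin> S} \<subseteq> {..<21}" using core_of_lt by auto
  hence "pos_dep (vec_of plus_list) ((!) core_of ` {k. k < 29 \<and> pt_ix k \<notin> S})"
    using pos_dep_superset[OF generic_vectors(1) _ assms] by simp
  thus ?thesis unfolding star_faces_def using assms(2,3) by blast
qed

lemma star_faces_mono: "S \<in> star_faces \<Longrightarrow> S' \<subseteq> S \<Longrightarrow> S' \<in> star_faces"
proof -
  assume S: "S \<in> star_faces" "S' \<subseteq> S"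
  show ?thesis
    by (rule star_faces_if_circuit[of "(!) core_of ` {k. k < 29 \<and> pt_ix k \<notin> S}"]) (use S in \<open>auto simp: star_faces_def\<close>)
qed

text \<open>Every vector of the base circuit \<open>0, 1, 2, 15\<close> has two copies, so it survives the removal of
  a label.\<close>
lemma star_faces_singleton: "{i} \<in> star_faces"
proof (rule star_faces_if_circuit[OF base_circuit])
  obtain m where m: "m < 30" "i = pt_ix m" by (rule pt_ix_cases)
  have *: "c \<in> (!) core_of ` {k. k < 29 \<and> pt_ix k \<notin> {i}}"
    if "a < 29" "b < 29" "a \<noteq> b" "core_of ! a = c" "core_of ! b = c" for a b c
  proof (cases "a = m")
    case True
    thus ?thesis using that m pt_ix_eq_iff[of b m] by (intro image_eqI[of _ _ b]) auto
  next
    case False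
    thus ?thesis using that m pt_ix_eq_iff[of a m] by (intro image_eqI[of _ _ a]) auto
  qed
  show "{0, 1, 2, 15} \<subseteq> (!) core_of ` {k. k < 29 \<and> pt_ix k \<notin> {i}}"
    using *[of 0 1 0] *[of 2 27 1] *[of 3 28 2] *[of 24 25 15] by (simp add: core_of_def)
qed simp

lemma delaunay_poset_configs: "delaunay_poset plus_config = star_faces" "delaunay_poset minus_config = star_faces"
  using delaunay_poset_eq[of plus_config] delaunay_poset_eq[of minus_config] star_faces_singleton lower_face_configs
  by auto

lemma star_face_of_circuit:
  assumes "pos_dep (vec_of plus_list) J" "J \<noteq> {}" "J \<subseteq> {..<21}"
  shows "- pt_ix ` rep ` J \<in> star_faces"
proof (rule star_faces_if_circuit[OF assms(1,2)])
  show "J \<subseteq> (!) core_of ` {k. k < 29 \<and> pt_ix k \<notin> - pt_ix ` rep ` J}"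
  proof
    fix k assume "k \<in> J"
    thus "k \<in> (!) core_of ` {k. k < 29 \<and> pt_ix k \<notin> - pt_ix ` rep ` J}"
      using assms(3) rep_lt[of k] core_of_rep[of k] by (intro image_eqI[of _ _ "rep k"]) auto
  qed
qed

lemma inj_on_pt_rep: "inj_on (\<lambda>k. pt_ix (rep k)) {..<21}"
proof (rule inj_onI)
  fix j k :: nat assume "j \<in> {..<21}" "k \<in> {..<21}" "pt_ix (rep j) = pt_ix (rep k)"
  thus "j = k" using pt_ix_eq_iff[of "rep j" "rep k"] rep_lt[of j] rep_lt[of k] inj_on_rep by (auto simp: inj_on_def)
qed

text \<open>Its complement carries a positive circuit, so all its subsets are cells, in every realization.\<close>
definition base_facet :: "30 set" where "base_facet = - pt_ix ` rep ` {0, 1, 2, 15}"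

lemma base_facet_mem: "base_facet \<in> star_faces"
  unfolding base_facet_def by (rule star_face_of_circuit[OF base_circuit]) auto

lemma card_base_facet: "card base_facet = 26"
proof -
  have "card ((\<lambda>k. pt_ix (rep k)) ` {0, 1, 2, 15}) = card {0, 1, 2, 15::nat}"
    by (rule card_image, rule inj_on_subset[OF inj_on_pt_rep]) auto
  thus ?thesis unfolding base_facet_def image_image Compl_eq_Diff_UNIV by (simp add: card_Diff_subset)
qed

lemma not_in_base_facet: "i \<notin> base_facet \<longleftrightarrow> i \<in> {pt_ix 26, pt_ix 27, pt_ix 28, pt_ix 16}"
  by (auto simp: base_facet_def rep_def)

lemma aff_dim_plus_config: "aff_dim (config_points plus_config) = 25"
proof -
  have "affine hull ((\<lambda>i. plus_config $ i) ` base_facet) = UNIV"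
    by (rule affine_hull_facet) (use lower_face_configs star_faces_mono[OF base_facet_mem] card_base_facet in auto)
  hence "affine hull (config_points plus_config) = UNIV"
    using hull_mono[of "(\<lambda>i. plus_config $ i) ` base_facet" "config_points plus_config" affine]
    by (auto simp: config_points_def)
  hence "aff_dim (config_points plus_config) = aff_dim (UNIV :: (real^25) set)" by (metis aff_dim_affine_hull)
  thus ?thesis by simp
qed

section \<open>Circuits of realizations, normalized\<close>

text \<open>Three elements of the circuit space, read row by row, attach a vector of \<open>\<real>\<^sup>3\<close> to
  each label.\<close>
type_synonym triple = "(real^30) \<times> (real^30) \<times> (real^30)"

definition frame_part :: "triple \<Rightarrow> nat \<Rightarrow> real^30" where
  "frame_part Y b = (if b = 0 then fst Y else if b = 1 then fst (snd Y) else snd (snd Y))"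

definition rep_vec :: "triple \<Rightarrow> nat \<Rightarrow> nat \<Rightarrow> real" where
  "rep_vec Y k b = frame_part Y b $ pt_ix (rep k)"

text \<open>The three vectors \<open>0, 1, 2\<close> become \<open>t\<close> times the standard basis. For
  \<open>t = 1\<close> this normalization makes the circuits unique; general \<open>t\<close> allows the frame to be
  scaled to a unit vector, which gives compactness.\<close>
definition frame :: "real \<Rightarrow> (25, 30) config \<Rightarrow> triple \<Rightarrow> bool" where
  "frame t B Y \<longleftrightarrow> (\<forall>b<3. frame_part Y b \<in> circuit_space B \<and> (\<forall>c<3. rep_vec Y c b = (if b = c then t else 0)))"

definition realizations :: "(25, 30) config set" where
  "realizations = {B. delaunay_poset B = star_faces}"

lemma realization_lower_face: "B \<in> realizations \<Longrightarrow> S \<in> star_faces \<Longrightarrow> lower_face B S"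
  using lower_face_if_mem_poset by (auto simp: realizations_def)

lemma frame_part_scale: "frame_part (r *\<^sub>R Y) b = r *\<^sub>R frame_part Y b" by (simp add: frame_part_def)

lemma rep_vec_scale: "rep_vec (r *\<^sub>R Y) k b = r * rep_vec Y k b" by (simp add: rep_vec_def frame_part_scale)

lemma circuit_space_scale: "y \<in> circuit_space B \<Longrightarrow> r *\<^sub>R y \<in> circuit_space B"
  unfolding circuit_space_def by (auto simp: sum_distrib_left[symmetric] mult.assoc)

lemma circuit_space_diff: "y \<in> circuit_space B \<Longrightarrow> z \<in> circuit_space B \<Longrightarrow> y - z \<in> circuit_space B"
  unfolding circuit_space_def by (auto simp: sum_subtractf left_diff_distrib)

lemma frame_scale: "frame t B Y \<Longrightarrow> frame (r * t) B (r *\<^sub>R Y)"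
  by (auto simp: frame_def frame_part_scale rep_vec_scale circuit_space_scale)

lemma secant_gap_scale: "secant_gap (rep_vec (r *\<^sub>R Y)) = r ^ 4 * secant_gap (rep_vec Y)"
  by (simp add: secant_gap_def rep_vec_scale power_def algebra_simps numeral_eq_Suc)

text \<open>A circuit that vanishes at three of the four labels off the base facet vanishes at the fourth one by the
  facet relation, and then on the facet.\<close>
lemma circuit_space_zero:
  assumes B: "B \<in> realizations" and y: "y \<in> circuit_space B" "\<And>c. c < 3 \<Longrightarrow> y $ pt_ix (rep c) = 0"
  shows "y = 0"
proof -
  obtain f where f: "\<And>i. i \<notin> base_facet \<Longrightarrow> 0 < f i"
      "\<And>y. y \<in> circuit_space B \<Longrightarrow> (\<Sum>i\<in>- base_facet. f i * y $ i) = 0"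
    using circuit_space_facet_relation[OF realization_lower_face[OF B base_facet_mem]] by blast
  have z: "y $ pt_ix 26 = 0" "y $ pt_ix 27 = 0" "y $ pt_ix 28 = 0"
    using y(2)[of 0] y(2)[of 1] y(2)[of 2] by (simp_all add: rep_def)
  have "(\<Sum>i\<in>- base_facet. f i * y $ i) = (\<Sum>i\<in>{pt_ix 16}. f i * y $ i)"
    by (rule sum.mono_neutral_right) (use not_in_base_facet z in auto)
  hence "y $ pt_ix 16 = 0" using f(2)[OF y(1)] f(1)[of "pt_ix 16"] not_in_base_facet by auto
  hence off: "y $ i = 0" if "i \<notin> base_facet" for i using that z unfolding not_in_base_facet by auto
  show ?thesis
    by (rule circuit_space_facet_inj[OF realization_lower_face[OF B star_faces_mono[OF base_facet_mem]] y(1) off])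
qed

lemma frame_unique:
  assumes B: "B \<in> realizations" and "frame t B Y" "frame t B Y'" shows "Y = Y'"
proof -
  have "frame_part Y b - frame_part Y' b = 0" if "b < 3" for b
    by (rule circuit_space_zero[OF B]) (use assms that in \<open>auto simp: frame_def rep_vec_def intro!: circuit_space_diff\<close>)
  from this[of 0] this[of 1] this[of 2] show ?thesis by (simp add: frame_part_def prod_eq_iff)
qed

lemma frame_exists:
  assumes B: "B \<in> realizations" obtains Y where "frame 1 B Y"
proof -
  obtain f where f: "\<And>i. i \<notin> base_facet \<Longrightarrow> 0 < f i"
      "\<And>y. y \<in> circuit_space B \<Longrightarrow> (\<Sum>i\<in>- base_facet. f i * y $ i) = 0"
    using circuit_space_facet_relation[OF realization_lower_face[OF B base_facet_mem]] by blast
  have ex: "\<exists>y. y \<in> circuit_space B \<and> (\<forall>c<3. y $ pt_ix (rep c) = (if b = c then 1 else 0))" if b: "b < 3" for b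
  proof -
    define t where "t i = (if i = pt_ix (rep b) then 1 else 0 :: real)" for i
    obtain y where y: "y \<in> circuit_space B" "\<And>i. i \<notin> base_facet \<Longrightarrow> i \<noteq> pt_ix 16 \<Longrightarrow> y $ i = t i"
    proof (rule circuit_space_facet_extend[of base_facet B f "pt_ix 16" t])
      show "\<And>S. S \<subseteq> base_facet \<Longrightarrow> lower_face B S" using realization_lower_face[OF B star_faces_mono[OF base_facet_mem]] .
    qed (use f in \<open>simp_all add: not_in_base_facet card_base_facet\<close>)
    have "y $ pt_ix (rep c) = (if b = c then 1 else 0)" if "c < 3" for c
    proof -
      have "rep c = 26 \<or> rep c = 27 \<or> rep c = 28" using that by (auto simp: rep_def)
      hence "y $ pt_ix (rep c) = t (pt_ix (rep c))"
        by (intro y(2)) (auto simp: not_in_base_facet pt_ix_eq_iff)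
      also have "\<dots> = (if b = c then 1 else 0)"
        using that b by (auto simp: t_def pt_ix_eq_iff rep_def)
      finally show ?thesis .
    qed
    thus ?thesis using y(1) by blast
  qed
  obtain y0 where y0: "y0 \<in> circuit_space B" "\<forall>c<3. y0 $ pt_ix (rep c) = (if 0 = c then 1 else 0)"
    using ex[of 0] by auto
  obtain y1 where y1: "y1 \<in> circuit_space B" "\<forall>c<3. y1 $ pt_ix (rep c) = (if 1 = c then 1 else 0)"
    using ex[of 1] by auto
  obtain y2 where y2: "y2 \<in> circuit_space B" "\<forall>c<3. y2 $ pt_ix (rep c) = (if 2 = c then 1 else 0)"
    using ex[of 2] by auto
  have "frame 1 B (y0, y1, y2)"
    using y0 y1 y2 unfolding frame_def all_less_3 by (simp add: frame_part_def rep_vec_def)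
  thus ?thesis using that by blast
qed

text \<open>For every realization the complements of the circuits in the chain are cells, so the
  vectors of the frame have these positive circuits, and the planar argument applies.\<close>
lemma frame_secant_gap:
  assumes B: "B \<in> realizations" and Y: "frame 1 B Y"
  shows "secant_gap (rep_vec Y) \<noteq> 0"
proof -
  define v where "v k b = (if b < 3 then rep_vec Y k b else 0)" for k b
  have basis: "v c b = (if b = c then 1 else 0)" if "c < 3" for c b
    using Y that by (auto simp: v_def frame_def)
  have "secant_gap v \<noteq> 0"
  proof (rule secant_gap_nonzero[OF _ _ _ forced_brackets])
    fix i j k l assume m: "(i, j, k, l) \<in> set circuit_chain"
    define J where "J = {i, j, k, l}"
    have J: "pos_dep (vec_of plus_list) J" "J \<subseteq> {..<21}" "J \<noteq> {}" "finite J"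
      using circuit_chain_pos_dep[OF m] by (auto simp: J_def)
    obtain f where f: "\<And>i. i \<notin> - pt_ix ` rep ` J \<Longrightarrow> 0 < f i"
        "\<And>y. y \<in> circuit_space B \<Longrightarrow> (\<Sum>i\<in>- (- pt_ix ` rep ` J). f i * y $ i) = 0"
      using circuit_space_facet_relation[OF realization_lower_face[OF B star_face_of_circuit[OF J(1,3,2)]]] by blast
    have "(\<Sum>k\<in>J. f (pt_ix (rep k)) * v k b) = 0" if "b < 3" for b
    proof -
      have "(\<Sum>k\<in>J. f (pt_ix (rep k)) * v k b) = (\<Sum>i\<in>(\<lambda>k. pt_ix (rep k)) ` J. f i * frame_part Y b $ i)"
        using that by (subst sum.reindex[OF inj_on_subset[OF inj_on_pt_rep J(2)]]) (simp add: v_def rep_vec_def)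
      thus ?thesis using f(2)[of "frame_part Y b"] Y that by (simp add: frame_def image_image)
    qed
    thus "pos_dep v {i, j, k, l}" unfolding pos_dep_def J_def[symmetric]
      by (intro exI[of _ "\<lambda>k. f (pt_ix (rep k))"]) (auto intro!: f(1))
  qed (use basis in auto)
  thus ?thesis by (simp add: secant_gap_def v_def)
qed

section \<open>Separating the realizations by the sign of the gap\<close>

text \<open>Whether the gap has the sign of \<open>s\<close>, in a form that makes sense for every configuration and
  depends on the circuit space only. Quantifying over unit frames with \<open>t \<ge> 0\<close> makes the set a
  projection along a compact factor, hence closed.\<close>
definition gap_side :: "real \<Rightarrow> (25, 30) config set" where
  "gap_side s = {B. \<exists>Y. Y \<in> sphere 0 1 \<and> (\<exists>t\<ge>0. frame t B Y) \<and> 0 \<le> s * secant_gap (rep_vec Y)}"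

lemma frame_iff:
  "frame t B Y \<longleftrightarrow> (\<forall>b<3. frame_part Y b \<in> circuit_space B) \<and> rep_vec Y 0 0 = t \<and> rep_vec Y 1 1 = t \<and> rep_vec Y 2 2 = t \<and>
     rep_vec Y 0 1 = 0 \<and> rep_vec Y 0 2 = 0 \<and> rep_vec Y 1 0 = 0 \<and> rep_vec Y 1 2 = 0 \<and> rep_vec Y 2 0 = 0 \<and> rep_vec Y 2 1 = 0"
  unfolding frame_def all_less_3 by auto

lemma closed_gap_side: "closed (gap_side s)"
proof -
  define T :: "(triple \<times> (25, 30) config) set" where
    "T = {(Y, B). frame (rep_vec Y 0 0) B Y \<and> 0 \<le> rep_vec Y 0 0 \<and> 0 \<le> s * secant_gap (rep_vec Y)}"
  have cp: "continuous_on UNIV (\<lambda>p :: triple \<times> (25, 30) config. frame_part (fst p) b $ i)" for b i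
    by (cases "b = 0"; cases "b = 1") (auto simp: frame_part_def intro!: continuous_intros)
  have cr: "continuous_on UNIV (\<lambda>p :: triple \<times> (25, 30) config. rep_vec (fst p) k b)" for k b
    unfolding rep_vec_def by (rule cp)
  have cg: "continuous_on UNIV (\<lambda>p :: triple \<times> (25, 30) config. secant_gap (rep_vec (fst p)))"
    unfolding secant_gap_def by (intro continuous_on_diff continuous_on_mult continuous_on_minus cr)
  have cd: "continuous_on UNIV (\<lambda>p :: triple \<times> (25, 30) config. dist (snd p $ i) (snd p $ j))" for i j
    by (intro continuous_intros)
  have C1: "closed {p :: triple \<times> (25, 30) config. frame_part (fst p) b \<in> circuit_space (snd p)}" for b
    unfolding circuit_space_def mem_Collect_eq
    by (intro closed_Collect_conj closed_Collect_all closed_Collect_eq continuous_on_sum continuous_on_mult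
        continuous_on_power cp cd continuous_on_const)
  have "T = {p. \<forall>b<3. frame_part (fst p) b \<in> circuit_space (snd p)} \<inter>
      {p. rep_vec (fst p) 1 1 = rep_vec (fst p) 0 0 \<and> rep_vec (fst p) 2 2 = rep_vec (fst p) 0 0 \<and>
        rep_vec (fst p) 0 1 = 0 \<and> rep_vec (fst p) 0 2 = 0 \<and> rep_vec (fst p) 1 0 = 0 \<and> rep_vec (fst p) 1 2 = 0 \<and>
        rep_vec (fst p) 2 0 = 0 \<and> rep_vec (fst p) 2 1 = 0 \<and> 0 \<le> rep_vec (fst p) 0 0 \<and> 0 \<le> s * secant_gap (rep_vec (fst p))}"
    unfolding T_def frame_iff by auto
  moreover have "closed \<dots>"
    unfolding all_less_3
    by (intro closed_Int closed_Collect_conj C1 closed_Collect_eq closed_Collect_le cr cg continuous_on_mult continuous_on_const)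
  ultimately have "closed T" by simp
  hence "closed {B. \<exists>Y. Y \<in> sphere 0 1 \<and> (Y, B) \<in> T}"
    by (intro closed_compact_projection) auto
  moreover have "gap_side s = {B. \<exists>Y. Y \<in> sphere 0 1 \<and> (Y, B) \<in> T}"
    unfolding gap_side_def T_def by (auto simp: frame_iff)
  ultimately show ?thesis by simp
qed

lemma gap_side_if_frame:
  assumes "frame 1 B Y" "0 \<le> s * secant_gap (rep_vec Y)" shows "B \<in> gap_side s"
proof -
  have "Y \<noteq> 0"
  proof
    assume "Y = 0"
    thus False using assms(1) by (auto simp: frame_iff rep_vec_def frame_part_def)
  qed
  hence n: "0 < norm Y" by simp
  define r where "r = 1 / norm Y"
  have "r *\<^sub>R Y \<in> sphere 0 1" using n by (simp add: r_def)
  moreover have "frame (r * 1) B (r *\<^sub>R Y)" using assms(1) by (rule frame_scale)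
  moreover have "0 \<le> s * secant_gap (rep_vec (r *\<^sub>R Y))" unfolding secant_gap_scale
    using mult_nonneg_nonneg[OF _ assms(2), of "r ^ 4"] by (simp add: mult_ac)
  ultimately show ?thesis unfolding gap_side_def using n
    by (intro CollectI exI[of _ "r *\<^sub>R Y"] conjI exI[of _ r]) (simp_all add: r_def)
qed

text \<open>A unit frame of a realization has \<open>t \<noteq> 0\<close>, hence is a multiple of the normalized
  frame, and the gap is homogeneous of degree \<open>4\<close>.\<close>
lemma gap_side_iff_frame:
  assumes B: "B \<in> realizations" and Y: "frame 1 B Y"
  shows "B \<in> gap_side s \<longleftrightarrow> 0 \<le> s * secant_gap (rep_vec Y)"
proof
  assume "B \<in> gap_side s"
  then obtain X t where X: "norm X = 1" "0 \<le> t" "frame t B X" "0 \<le> s * secant_gap (rep_vec X)"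
    by (auto simp: gap_side_def)
  have eq: "X = t *\<^sub>R Y" using frame_unique[OF B X(3)] frame_scale[OF Y, of t] by simp
  hence t: "t \<noteq> 0" using X(1) by auto
  have "0 \<le> t ^ 4 * (s * secant_gap (rep_vec Y))" using X(4) unfolding eq secant_gap_scale by (simp add: mult_ac)
  moreover have "0 < t ^ 4" using t by simp
  ultimately show "0 \<le> s * secant_gap (rep_vec Y)" by (simp add: zero_le_mult_iff)
qed (rule gap_side_if_frame[OF Y])

lemma realization_on_one_side:
  assumes "B \<in> realizations" shows "B \<in> gap_side 1 \<longleftrightarrow> B \<notin> gap_side (- 1)"
proof -
  obtain Y where Y: "frame 1 B Y" using frame_exists[OF assms] .
  show ?thesis using frame_secant_gap[OF assms Y] gap_side_iff_frame[OF assms Y] by auto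
qed

lemma gap_side_similar: "similarity_orbit B = similarity_orbit B' \<Longrightarrow> B \<in> gap_side s \<longleftrightarrow> B' \<in> gap_side s"
  using similarity_orbit_eq_circuit_space[of B B'] by (simp add: gap_side_def frame_def)

text \<open>The frame of the constructed configuration consists of the given vectors up to positive factors, which
  come out of the multilinear gap.\<close>
lemma frame_config_of:
  assumes L: "feasible L"
  obtains Y where "frame 1 (config_of L) Y" "\<exists>c>0. secant_gap (rep_vec Y) = c * secant_gap (vec_of L)"
proof -
  define y where "y b = (\<chi> n. let k = inv_into {..<30} pt_ix n in if k < 29 then star_vec (wt L) k b else 0)" for b
  have y: "y b $ pt_ix k = star_vec (wt L) k b" if "k < 29" for k b
    using that bij_pt_ix by (simp add: bij_betw_def y_def Let_def)
  have cs: "y b \<in> circuit_space (config_of L)" if "b < 3" for b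
    unfolding y_def config_of_def
    by (rule star_circuit_space) (use that L in \<open>auto simp: sqlen_pos wt_sum wt_sqlen_sum sqlen_def[of L 0]\<close>)
  define Y where "Y = (y 0, y 1, y 2)"
  have pY: "frame_part Y b = y b" if "b < 3" for b using that by (auto simp: b_cases frame_part_def Y_def)
  have rv: "rep_vec Y k b = copy_scale L (rep k) * vec_of L k b" if "k < 21" "b < 3" for k b
    using that y[OF rep_lt[of k]] star_vec_eq[OF L rep_lt[of k], of b] core_of_rep[of k] by (simp add: rep_vec_def pY)
  have "frame 1 (config_of L) Y" unfolding frame_def
  proof (intro allI impI conjI)
    fix b c :: nat assume bc: "b < 3" "c < 3"
    have "rep_vec Y c b = copy_scale L (rep c) * (if b = c then 1 else 0)" using rv[of c b] bc vec_basis[OF L, of c b] by simp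
    moreover have "copy_scale L (rep c) = 1" using bc by (simp add: rep_def copy_scale_def)
    ultimately show "rep_vec Y c b = (if b = c then 1 else 0)" by simp
  qed (simp add: pY cs)
  moreover define c where "c = copy_scale L (rep 5) * copy_scale L (rep 6) * copy_scale L (rep 7) * copy_scale L (rep 8)"
  have "0 < c" unfolding c_def using copy_scale_pos[OF L] by (simp add: rep_def)
  moreover have "secant_gap (rep_vec Y) = c * secant_gap (vec_of L)"
    unfolding secant_gap_def c_def by (simp add: rv algebra_simps)
  ultimately show ?thesis using that by blast
qed

lemma secant_gap_vectors: "0 < secant_gap (vec_of plus_list)" "secant_gap (vec_of minus_list) < 0"
  by (simp_all add: secant_gap_def vec_of_def plus_list_def minus_list_def)

lemma configs_on_sides: "plus_config \<in> gap_side 1" "minus_config \<in> gap_side (- 1)"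
proof -
  show "plus_config \<in> gap_side 1"
    using frame_config_of[OF feasible_vectors(1)] gap_side_if_frame secant_gap_vectors(1) unfolding plus_config_def
    by (metis mult_1 mult_nonneg_nonneg less_imp_le)
  obtain Y where "frame 1 minus_config Y" "\<exists>c>0. secant_gap (rep_vec Y) = c * secant_gap (vec_of minus_list)"
    using frame_config_of[OF feasible_vectors(2)] unfolding minus_config_def by blast
  thus "minus_config \<in> gap_side (- 1)"
    using secant_gap_vectors(2) by (auto intro!: gap_side_if_frame mult_nonneg_nonpos)
qed

text \<open>Both sides are relatively closed and complementary in the set of realizations, so both are open; they
  consist of whole similarity classes and contain one of the two configurations each.\<close>
lemma disconnected: "\<not> connected_space (delaunay_realization_space star_faces :: (25, 30) config set topology)"
proof
  let ?X = "delaunay_realization_space star_faces :: (25, 30) config set topology"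
  define U where "U s = similarity_orbit ` (realizations \<inter> gap_side s)" for s
  have top: "topspace ?X = similarity_orbit ` realizations"
    by (simp add: delaunay_realization_space_def realizations_def)
  have op: "openin ?X (U s)" if "s = 1 \<or> s = - 1" for s
  proof -
    have "{B \<in> realizations. similarity_orbit B \<in> U s} = realizations \<inter> gap_side s"
      unfolding U_def using gap_side_similar by blast
    also have "\<dots> = realizations \<inter> - gap_side (- s)"
      using realization_on_one_side that by auto
    finally have "openin (top_of_set realizations) {B \<in> realizations. similarity_orbit B \<in> U s}"
      using closed_gap_side[of "- s"] by (simp add: openin_open_Int open_Compl)
    thus ?thesis unfolding delaunay_realization_space_def openin_quotient_topology realizations_def[symmetric]
      by (auto simp: U_def)
  qed
  have conf: "plus_config \<in> realizations" "minus_config \<in> realizations"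
    by (simp_all add: realizations_def delaunay_poset_configs)
  assume "connected_space ?X"
  moreover have "topspace ?X \<subseteq> U 1 \<union> U (- 1)" unfolding top U_def using realization_on_one_side by blast
  moreover have "U 1 \<inter> U (- 1) = {}"
    unfolding U_def using realization_on_one_side gap_side_similar by blast
  moreover have "U 1 \<noteq> {}" "U (- 1) \<noteq> {}" using conf configs_on_sides by (auto simp: U_def)
  ultimately show False using op[of 1] op[of "- 1"] unfolding connected_space_def by blast
qed

theorem corollary4p18:
  shows "\<exists>A :: (25, 30) config.
           inj (\<lambda>i. A $ i) \<and> aff_dim (config_points A) = 25 \<and>
           is_delaunay_triangulation A \<and>
           \<not> connected_space
               (delaunay_realization_space (delaunay_poset A) :: (25, 30) config set topology)"
proof (intro exI[of _ plus_config] conjI)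
  show "inj (\<lambda>i. plus_config $ i)"
    by (rule inj_if_singleton_faces) (simp add: lower_face_configs star_faces_singleton)
  show "is_delaunay_triangulation plus_config"
    by (rule triangulation_if_faces_hereditary)
      (use lower_face_configs star_faces_singleton star_faces_mono in auto)
qed (simp_all add: aff_dim_plus_config delaunay_poset_configs disconnected)

end
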